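(* Assume conditions A1, A2, A3 (listed in the context). For a rejection region $C\subset\mathbb{R}^n$ and a density $f\in\{g_\theta:\theta\in\Theta\}\cup\{h_\gamma:\gamma\in\Gamma\}$ define the risk $$R(C,f)=\begin{cases}P_f((X_1,\dots,X_n)\in C)& \text{if } f\in\{g_\theta:\theta\in\Theta\},\\ P_f((X_1,\dots,X_n)\in C^c)&\text{if } f\in\{h_\gamma:\gamma\in\Gamma\}.\end{cases}$$ Let $\rho=\min_{\theta\in\Theta,\gamma\in\Gamma}\rho_{\theta\gamma}$, where $\rho_{\theta\gamma}$ is the Chernoff index between $g_\theta$ and $h_\gamma$. Then, as $n\to\infty$, the minimax risk satisfies $$\min_{C\subset\mathbb{R}^n}\ \max_{f\in\{g_\theta\}\cup\{h_\gamma\}}\frac{\log R(C,f)}{n}\ \to\ -\rho,$$ and the maximum risk of the generalized likelihood ratio rejection region $C_1=\{LR_n>1\}$, with $LR_n=\max_{\gamma\in\Gamma}\prod_{i=1}^n h_\gamma(X_i)/\max_{\theta\in\Theta}\prod_{i=1}^n g_\theta(X_i)$, achieves this same exponential decay rate, i.e. $\frac1n\max_f\log R(C_1,f)\to-\rho$.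
   Context: Setting: $\{g_\theta:\theta\in\Theta\}$ and $\{h_\gamma:\gamma\in\Gamma\}$ are two parametric families of probability densities on $\mathbb{R}$ with respect to a common baseline measure $\mu$; all distributions in the two families are mutually absolutely continuous. $P_f$ and $E_f$ denote probability and expectation when $X,X_1,X_2,\dots$ are i.i.d. with density $f$. The minimum over $C$ is over (measurable) subsets of $\mathbb{R}^n$, and min/max are understood as inf/sup where necessary. Chernoff index: for densities $g,h$ let $l=\log h(X)-\log g(X)$, $M_g(z)=E_g(e^{zl})=\int (h/g)^z g\,d\mu$, $m_g(t)=\max_z[zt-\log M_g(z)]$. Switching the roles of $g$ and $h$, let $M_h(z)=E_h[e^{z(\log g(X)-\log h(X))}]$ and $m_h(t)=\max_z[zt-\log M_h(z)]$. The Chernoff index between $g$ and $h$ is $\max_{E_g(l)<t<E_h(l)}\min\{m_g(t),m_h(-t)\}$; it is attained at $t=0$ and equals $\max_z[-\log M_g(z)]$. $\rho_{\theta\gamma}$ is this quantity for $g=g_\theta$, $h=h_\gamma$. Conditions: A1 (complete separation): $\min_{\theta\in\Theta,\gamma\in\Gamma}E_{g_\theta}\{\log g_\theta(X)-\log h_\gamma(X)\}>0$. A2: $\Theta\subset\mathbb{R}^{d_g}$ and $\Gamma\subset\mathbb{R}^{d_h}$ are compact with continuously differentiable boundaries $\partial\Theta$, $\partial\Gamma$. A3: with $l_{\theta\gamma}=\log h_\gamma(X)-\log g_\theta(X)$ (differentiable in $\theta$ and $\gamma$), $S_1=\sup_{\theta,\gamma}|\nabla_\theta l_{\theta\gamma}|$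 and $S_2=\sup_{\theta,\gamma}|\nabla_\gamma l_{\theta\gamma}|$, there exist $\eta,x_0>0$, independent of $\theta$ and $\gamma$, such that for all $x>x_0$ and $i=1,2$, $\sup_{\theta\in\Theta,\gamma\in\Gamma}\max\{P_{g_\theta}(S_i>x),P_{h_\gamma}(S_i>x)\}\le e^{-(\log x)^{1+\eta}}$. *)

theory Defs
  imports "HOL-Probability.Probability"
begin

definition prob_density :: "real measure \<Rightarrow> (real \<Rightarrow> real) \<Rightarrow> bool" where
  "prob_density \<mu> f \<longleftrightarrow>
     f \<in> borel_measurable \<mu> \<and> (\<forall>x. 0 \<le> f x) \<and> (\<integral>\<^sup>+ x. ennreal (f x) \<partial>\<mu>) = 1"

definition law :: "real measure \<Rightarrow> (real \<Rightarrow> real) \<Rightarrow> real measure" where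
  "law \<mu> f = density \<mu> (\<lambda>x. ennreal (f x))"

definition sample_law :: "real measure \<Rightarrow> (real \<Rightarrow> real) \<Rightarrow> nat \<Rightarrow> (nat \<Rightarrow> real) measure" where
  "sample_law \<mu> f n = (\<Pi>\<^sub>M i\<in>{..<n}. law \<mu> f)"


subsection \<open>Extended-valued logarithm and expectation\<close>

text \<open>Logarithms of moment generating functions may be \<open>\<infinity>\<close> and logarithms of error
  probabilities may be \<open>-\<infinity>\<close>; the library's real \<open>ln\<close> and Bochner integral would
  replace these values by finite defaults.\<close>

definition elog :: "ennreal \<Rightarrow> ereal" where
  "elog x = (if x = 0 then - \<infinity> else if x = \<infinity> then \<infinity> else ereal (ln (enn2real x)))"

text \<open>Every expectation below is of a log-likelihood ratio, for which at least one of the two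
  integrals is at most 1, so the difference is never \<open>\<infinity> - \<infinity>\<close>.\<close>

definition eexpectation :: "real measure \<Rightarrow> (real \<Rightarrow> real) \<Rightarrow> ereal" where
  "eexpectation M X =
     enn2ereal (\<integral>\<^sup>+ x. ennreal (X x) \<partial>M) - enn2ereal (\<integral>\<^sup>+ x. ennreal (- X x) \<partial>M)"


subsection \<open>The Chernoff index\<close>

definition loglr :: "(real \<Rightarrow> real) \<Rightarrow> (real \<Rightarrow> real) \<Rightarrow> real \<Rightarrow> real" where
  "loglr g h x = ln (h x) - ln (g x)"

definition mgf :: "real measure \<Rightarrow> (real \<Rightarrow> real) \<Rightarrow> (real \<Rightarrow> real) \<Rightarrow> real \<Rightarrow> ennreal" where
  "mgf \<mu> g h z = (\<integral>\<^sup>+ x. ennreal (exp (z * loglr g h x)) \<partial>law \<mu> g)"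

definition rate_fun :: "real measure \<Rightarrow> (real \<Rightarrow> real) \<Rightarrow> (real \<Rightarrow> real) \<Rightarrow> real \<Rightarrow> ereal" where
  "rate_fun \<mu> g h t = (SUP z::real. ereal (z * t) - elog (mgf \<mu> g h z))"

text \<open>Exchanging the two densities turns \<open>M\<^sub>g, m\<^sub>g\<close> into \<open>M\<^sub>h, m\<^sub>h\<close>.\<close>

definition chernoff_index :: "real measure \<Rightarrow> (real \<Rightarrow> real) \<Rightarrow> (real \<Rightarrow> real) \<Rightarrow> ereal" where
  "chernoff_index \<mu> g h =
     (SUP t \<in> {t::real. eexpectation (law \<mu> g) (loglr g h) < ereal t \<and>
                        ereal t < eexpectation (law \<mu> h) (loglr g h)}.
        min (rate_fun \<mu> g h t) (rate_fun \<mu> h g (- t)))"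


subsection \<open>Conditions A1--A3\<close>

definition condition_A1 ::
  "real measure \<Rightarrow> 'a set \<Rightarrow> 'b set \<Rightarrow> ('a \<Rightarrow> real \<Rightarrow> real) \<Rightarrow> ('b \<Rightarrow> real \<Rightarrow> real) \<Rightarrow> bool" where
  "condition_A1 \<mu> \<Theta> \<Gamma> g h \<longleftrightarrow>
     0 < (INF \<theta>\<in>\<Theta>. INF \<gamma>\<in>\<Gamma>. eexpectation (law \<mu> (g \<theta>)) (\<lambda>x. ln (g \<theta> x) - ln (h \<gamma> x)))"

text \<open>Near each boundary point the set is the sublevel set of a \<open>C\<^sup>1\<close> function \<open>\<phi>\<close> with
  nonvanishing gradient \<open>\<phi>'\<close>, so that it lies on one side of the \<open>C\<^sup>1\<close> hypersurface
  \<open>\<phi> = 0\<close>.\<close>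

definition C1_boundary :: "'a::euclidean_space set \<Rightarrow> bool" where
  "C1_boundary S \<longleftrightarrow>
     (\<forall>p\<in>frontier S. \<exists>U \<phi> \<phi>'. open U \<and> p \<in> U \<and>
        (\<forall>x\<in>U. (\<phi> has_derivative (\<lambda>v. \<phi>' x \<bullet> v)) (at x) \<and> \<phi>' x \<noteq> 0) \<and>
        continuous_on U \<phi>' \<and>
        S \<inter> U = {x \<in> U. \<phi> x \<le> (0::real)})"

definition condition_A2 :: "'a::euclidean_space set \<Rightarrow> 'b::euclidean_space set \<Rightarrow> bool" where
  "condition_A2 \<Theta> \<Gamma> \<longleftrightarrow> compact \<Theta> \<and> C1_boundary \<Theta> \<and> compact \<Gamma> \<and> C1_boundary \<Gamma>"

text \<open>The gradient relative to a set \<open>S\<close>, one-sided at boundary points; it is unique when \<open>S\<close>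
  is closed with \<open>C\<^sup>1\<close> boundary.\<close>

definition gradient_within :: "('a::euclidean_space \<Rightarrow> real) \<Rightarrow> 'a set \<Rightarrow> 'a \<Rightarrow> 'a" where
  "gradient_within f S x = (SOME D. (f has_derivative (\<lambda>v. D \<bullet> v)) (at x within S))"

definition score1 ::
  "'a::euclidean_space set \<Rightarrow> 'b::euclidean_space set \<Rightarrow>
   ('a \<Rightarrow> real \<Rightarrow> real) \<Rightarrow> ('b \<Rightarrow> real \<Rightarrow> real) \<Rightarrow> real \<Rightarrow> ennreal" where
  "score1 \<Theta> \<Gamma> g h x =
     (SUP \<theta>\<in>\<Theta>. SUP \<gamma>\<in>\<Gamma>. ennreal (norm (gradient_within (\<lambda>\<theta>'. loglr (g \<theta>') (h \<gamma>) x) \<Theta> \<theta>)))"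

definition score2 ::
  "'a::euclidean_space set \<Rightarrow> 'b::euclidean_space set \<Rightarrow>
   ('a \<Rightarrow> real \<Rightarrow> real) \<Rightarrow> ('b \<Rightarrow> real \<Rightarrow> real) \<Rightarrow> real \<Rightarrow> ennreal" where
  "score2 \<Theta> \<Gamma> g h x =
     (SUP \<theta>\<in>\<Theta>. SUP \<gamma>\<in>\<Gamma>. ennreal (norm (gradient_within (\<lambda>\<gamma>'. loglr (g \<theta>) (h \<gamma>') x) \<Gamma> \<gamma>)))"

text \<open>Almost surely all densities are positive at the observation (so that the log-likelihood
  ratios are well defined) and the log-likelihood ratios are differentiable in both parameters.
  By mutual absolute continuity it does not matter under which of the laws this is required.\<close>

definition differentiable_loglr ::
  "real measure \<Rightarrow> 'a::euclidean_space set \<Rightarrow> 'b::euclidean_space set \<Rightarrow>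
   ('a \<Rightarrow> real \<Rightarrow> real) \<Rightarrow> ('b \<Rightarrow> real \<Rightarrow> real) \<Rightarrow> bool" where
  "differentiable_loglr \<mu> \<Theta> \<Gamma> g h \<longleftrightarrow>
     (\<forall>f \<in> g ` \<Theta> \<union> h ` \<Gamma>. AE x in law \<mu> f. \<forall>\<theta>\<in>\<Theta>. \<forall>\<gamma>\<in>\<Gamma>.
        0 < g \<theta> x \<and> 0 < h \<gamma> x \<and>
        (\<lambda>\<theta>'. loglr (g \<theta>') (h \<gamma>) x) differentiable (at \<theta> within \<Theta>) \<and>
        (\<lambda>\<gamma>'. loglr (g \<theta>) (h \<gamma>') x) differentiable (at \<gamma> within \<Gamma>))"

text \<open>The suprema \<open>S\<^sub>1, S\<^sub>2\<close> over uncountable sets need not be Borel functions of the observation;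
  the outer measure is their tail probability whenever the events are measurable. The value of
  \<open>(ln x) powr (1 + \<eta>)\<close> for \<open>x \<le> 1\<close> is immaterial, since \<open>x\<^sub>0\<close> may be enlarged.\<close>

definition condition_A3 ::
  "real measure \<Rightarrow> 'a::euclidean_space set \<Rightarrow> 'b::euclidean_space set \<Rightarrow>
   ('a \<Rightarrow> real \<Rightarrow> real) \<Rightarrow> ('b \<Rightarrow> real \<Rightarrow> real) \<Rightarrow> bool" where
  "condition_A3 \<mu> \<Theta> \<Gamma> g h \<longleftrightarrow>
     differentiable_loglr \<mu> \<Theta> \<Gamma> g h \<and>
     (\<exists>\<eta>>0. \<exists>x\<^sub>0>0. \<forall>x>x\<^sub>0. \<forall>S \<in> {score1 \<Theta> \<Gamma> g h, score2 \<Theta> \<Gamma> g h}.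
        (SUP \<theta>\<in>\<Theta>. SUP \<gamma>\<in>\<Gamma>.
           max (outer_measure_of (law \<mu> (g \<theta>)) {y. S y > ennreal x})
               (outer_measure_of (law \<mu> (h \<gamma>)) {y. S y > ennreal x}))
        \<le> ennreal (exp (- ((ln x) powr (1 + \<eta>)))))"


subsection \<open>Risk and the generalized likelihood ratio test\<close>

definition sample_space :: "nat \<Rightarrow> (nat \<Rightarrow> real) measure" where
  "sample_space n = (\<Pi>\<^sub>M i\<in>{..<n}. borel)"

text \<open>The completion is only relevant to the generalized likelihood ratio region, which is
  measurable up to null sets because the densities are only almost surely continuous in the
  parameters. Under condition A1 the two families are disjoint, so the case distinction on \<open>f\<close> is
  unambiguous.\<close>

definition risk ::
  "real measure \<Rightarrow> (real \<Rightarrow> real) set \<Rightarrow> nat \<Rightarrow> (nat \<Rightarrow> real) set \<Rightarrow> (real \<Rightarrow> real) \<Rightarrow> ennreal" where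
  "risk \<mu> G n C f =
     (if f \<in> G then emeasure (completion (sample_law \<mu> f n)) C
      else emeasure (completion (sample_law \<mu> f n)) (space (sample_space n) - C))"

definition max_log_risk ::
  "real measure \<Rightarrow> (real \<Rightarrow> real) set \<Rightarrow> (real \<Rightarrow> real) set \<Rightarrow> nat \<Rightarrow> (nat \<Rightarrow> real) set \<Rightarrow> ereal" where
  "max_log_risk \<mu> G H n C = (SUP f \<in> G \<union> H. elog (risk \<mu> G n C f) / ereal (real n))"

definition LR ::
  "'a set \<Rightarrow> 'b set \<Rightarrow> ('a \<Rightarrow> real \<Rightarrow> real) \<Rightarrow> ('b \<Rightarrow> real \<Rightarrow> real) \<Rightarrow> nat \<Rightarrow> (nat \<Rightarrow> real) \<Rightarrow> real" where
  "LR \<Theta> \<Gamma> g h n x =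
     (SUP \<gamma>\<in>\<Gamma>. \<Prod>i<n. h \<gamma> (x i)) / (SUP \<theta>\<in>\<Theta>. \<Prod>i<n. g \<theta> (x i))"

definition GLR_region ::
  "'a set \<Rightarrow> 'b set \<Rightarrow> ('a \<Rightarrow> real \<Rightarrow> real) \<Rightarrow> ('b \<Rightarrow> real \<Rightarrow> real) \<Rightarrow> nat \<Rightarrow> (nat \<Rightarrow> real) set" where
  "GLR_region \<Theta> \<Gamma> g h n = {x \<in> space (sample_space n). LR \<Theta> \<Gamma> g h n x > 1}"

end

(* Idea: for a single pair of densities g, h with log-likelihood ratio l = log h - log g, the moment
   generating function M(z) = E_g exp(z l) equals 1 at z = 0 and z = 1 and attains its minimum
   exp(-c) at an interior point; Jensen's inequality outside [0, 1] shows that the Chernoff index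
   is c. Tilting g by exp(z l) at the minimizer gives a law under which l has mean 0, and comparing
   both error probabilities with it bounds their sum below by exp(-n (c + eps)).

   For the upper bound, an error of the likelihood ratio test under g_theta forces
   sum_i l_{theta,gamma}(X_i) >= 0 for some gamma. With B_n = exp(n^a), 1 / (1 + eta) < a < 1, A3
   makes the event that some score exceeds B_n superexponentially unlikely. Otherwise gamma may be
   replaced by a point of a net of mesh proportional to 1 / B_n, at a cost of n eps in the exponent:
   the C^1 boundary allows gradient bounds to be integrated inside the parameter set. The net has
   only exp(O(n^a)) points, so Cramer's bound at each of them and a union bound suffice. *)

theory Submission
  imports Defs "HOL-Real_Asymp.Real_Asymp"
begin

section \<open>Extended logarithms and expectations\<close>

text \<open>Moments may be infinite outside [0, 1], and so may the means of \<open>l\<close>.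
  Therefore \<open>M\<close> is used as a real function only on [0, 1], where convexity of exp makes
  it finite; elsewhere only the extended-valued \<open>emgf\<close> occurs. That the tilted law is
  centred is shown without differentiating \<open>M\<close>: a nonzero mean would let a second-order
  bound drop below the minimum. The upper bound has to hold from one n on for all parameters,
  whereas the lower bound only needs a single pair with index close to \<rho>. Under
  \<open>g \<theta>\<close> the maximum over \<Theta> is at least the likelihood at the true
  \<theta>, so each kind of error needs a net in the opposite parameter set only. One net point must
  serve all n observations at once, hence it is chosen before the functions to be compared. Suprema
  over uncountable parameter sets leave the likelihood ratio region measurable only up to null sets;
  its risks are computed from a Borel version built on countable dense sets.\<close>

lemma elog_ennreal: "0 < x \<Longrightarrow> elog (ennreal x) = ereal (ln x)"
  by (simp add: elog_def)

lemma elog_ennreal_exp [simp]: "elog (ennreal (exp y)) = ereal y"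
  by (simp add: elog_ennreal)

lemma elog_mono:
  assumes "x \<le> y" shows "elog x \<le> elog y"
proof (cases y)
  case (real b)
  then obtain a where a: "x = ennreal a" "0 \<le> a" "a \<le> b"
    using assms by (cases x) (auto simp: top_unique)
  then show ?thesis
    using real by (cases "a = 0") (auto simp: elog_ennreal elog_def[of 0])
qed (auto simp: elog_def)

lemma eexpectation_eq_integral:
  assumes "integrable M X"
  shows "eexpectation M X = ereal (integral\<^sup>L M X)"
proof -
  have "(\<integral>\<^sup>+ x. ennreal (X x) \<partial>M) < \<infinity>" "(\<integral>\<^sup>+ x. ennreal (- X x) \<partial>M) < \<infinity>"
    using assms by (auto simp: real_integrable_def top.not_eq_extremum)
  then show ?thesis
    unfolding eexpectation_def real_lebesgue_integral_def[OF assms]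
    by (cases "\<integral>\<^sup>+ x. ennreal (X x) \<partial>M"; cases "\<integral>\<^sup>+ x. ennreal (- X x) \<partial>M")
       (auto simp: enn2ereal_ennreal)
qed

lemma eexpectation_eq_infinity:
  assumes "(\<integral>\<^sup>+ x. ennreal (X x) \<partial>M) = \<infinity>" "(\<integral>\<^sup>+ x. ennreal (- X x) \<partial>M) < \<infinity>"
  shows "eexpectation M X = \<infinity>"
  using assms unfolding eexpectation_def
  by (cases "\<integral>\<^sup>+ x. ennreal (- X x) \<partial>M") (auto simp: enn2ereal_ennreal)

lemma eexpectation_uminus:
  assumes "(\<integral>\<^sup>+ x. ennreal (- X x) \<partial>M) < \<infinity>"
  shows "eexpectation M (\<lambda>x. - X x) = - eexpectation M X"
  using assms unfolding eexpectation_def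
  by (cases "\<integral>\<^sup>+ x. ennreal (- X x) \<partial>M"; cases "\<integral>\<^sup>+ x. ennreal (X x) \<partial>M")
     (auto simp: enn2ereal_ennreal)

lemma integrable_if_nn_integrals_finite:
  fixes X :: "real \<Rightarrow> real"
  assumes "X \<in> borel_measurable M" "(\<integral>\<^sup>+ x. ennreal (X x) \<partial>M) \<noteq> \<infinity>"
    "(\<integral>\<^sup>+ x. ennreal (- X x) \<partial>M) < \<infinity>"
  shows "integrable M X"
  using assms by (auto simp: real_integrable_def)

text \<open>Jensen's inequality in a form that survives infinite means: integrate the tangent
  \<open>exp (s * t) * (1 + s * (X x - t))\<close>, whose mean is at least
  \<open>exp (s * t)\<close> because \<open>t\<close> lies below the mean of \<open>X\<close>. If
  the exponential moment is finite, it bounds the positive part of \<open>X\<close>, so the mean is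
  then finite as well.\<close>

lemma exp_moment_ge:
  assumes "prob_space N"
    and X[measurable]: "X \<in> borel_measurable N" and neg: "(\<integral>\<^sup>+ x. ennreal (- X x) \<partial>N) < \<infinity>"
    and t: "ereal t < eexpectation N X" and s: "0 \<le> s"
  shows "ennreal (exp (s * t)) \<le> (\<integral>\<^sup>+ x. ennreal (exp (s * X x)) \<partial>N)"
proof (cases "(\<integral>\<^sup>+ x. ennreal (exp (s * X x)) \<partial>N) = \<infinity>")
  case False
  interpret prob_space N by fact
  show ?thesis
  proof (cases "s = 0")
    case True
    then show ?thesis by (simp add: emeasure_space_1)
  next
    case False
    with s have "s > 0" by simp
    have int: "integrable N (\<lambda>x. exp (s * X x))"
      using \<open>(\<integral>\<^sup>+ x. ennreal (exp (s * X x)) \<partial>N) \<noteq> \<infinity>\<close>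
      by (intro integrableI_nonneg) (auto simp: top.not_eq_extremum)
    have "(\<integral>\<^sup>+ x. ennreal s * ennreal (X x) \<partial>N) \<le> (\<integral>\<^sup>+ x. ennreal (exp (s * X x)) \<partial>N)"
      using \<open>s > 0\<close>
      by (intro nn_integral_mono)
         (auto simp flip: ennreal_mult' intro!: ennreal_leI order.trans[OF _ exp_ge_add_one_self])
    then have "(\<integral>\<^sup>+ x. ennreal (X x) \<partial>N) \<noteq> \<infinity>"
      using \<open>s > 0\<close> \<open>(\<integral>\<^sup>+ x. ennreal (exp (s * X x)) \<partial>N) \<noteq> \<infinity>\<close>
      by (auto simp: nn_integral_cmult ennreal_mult_top top_unique)
    then have X_int: "integrable N X"
      using neg by (intro integrable_if_nn_integrals_finite) auto
    then have "t < (\<integral>x. X x \<partial>N)"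
      using t by (simp add: eexpectation_eq_integral)
    then have "exp (s * t) \<le> exp (s * t) * (1 + s * ((\<integral>x. X x \<partial>N) - t))"
      using \<open>s > 0\<close> by simp
    also have "\<dots> = (\<integral>x. exp (s * t) * (1 + s * (X x - t)) \<partial>N)"
      using X_int by (simp add: prob_space)
    also have "\<dots> \<le> (\<integral>x. exp (s * X x) \<partial>N)"
    proof (rule integral_mono)
      fix x
      have "1 + s * (X x - t) \<le> exp (s * (X x - t))"
        by (rule exp_ge_add_one_self)
      then have "exp (s * t) * (1 + s * (X x - t)) \<le> exp (s * t) * exp (s * (X x - t))"
        by simp
      then show "exp (s * t) * (1 + s * (X x - t)) \<le> exp (s * X x)"
        by (simp add: algebra_simps flip: exp_add)
    qed (use X_int int in auto)
    finally show ?thesis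
      by (subst nn_integral_eq_integral[OF int]) (auto intro!: ennreal_leI)
  qed
qed simp

section \<open>The Chernoff index of two densities\<close>

text \<open>\<open>P\<close> stands for the law of g and \<open>l\<close> for the log-likelihood
  ratio log h - log g. The second assumption says that \<open>exp (l x)\<close> is the density of a
  probability law, that of h; the third is A1 for this pair.\<close>

locale chernoff_pair = prob_space P for P :: "real measure" +
  fixes l :: "real \<Rightarrow> real"
  assumes l_measurable [measurable]: "l \<in> borel_measurable P"
    and nn_integral_exp_l: "(\<integral>\<^sup>+x. ennreal (exp (l x)) \<partial>P) = 1"
    and separated: "0 < eexpectation P (\<lambda>x. - l x)"
begin

definition Q :: "real measure" where
  "Q = density P (\<lambda>x. ennreal (exp (l x)))"

definition emgf :: "real \<Rightarrow> ennreal" where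
  "emgf z = (\<integral>\<^sup>+x. ennreal (exp (z * l x)) \<partial>P)"

definition M :: "real \<Rightarrow> real" where
  "M z = (\<integral>x. exp (z * l x) \<partial>P)"

lemma sets_Q [simp, measurable_cong]: "sets Q = sets P"
  by (simp add: Q_def)

lemma prob_space_Q: "prob_space Q"
  by (rule prob_spaceI) (simp add: Q_def emeasure_density nn_integral_exp_l cong: nn_integral_cong)

lemma nn_integral_Q:
  "f \<in> borel_measurable P \<Longrightarrow> (\<integral>\<^sup>+x. f x \<partial>Q) = (\<integral>\<^sup>+x. ennreal (exp (l x)) * f x \<partial>P)"
  unfolding Q_def by (rule nn_integral_density) auto

lemma emgf_Q: "(\<integral>\<^sup>+x. ennreal (exp (z * l x)) \<partial>Q) = emgf (1 + z)"
  by (subst nn_integral_Q) (auto simp: emgf_def distrib_right exp_add simp flip: ennreal_mult' intro!: nn_integral_cong)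

lemma nn_integral_l_finite: "(\<integral>\<^sup>+x. ennreal (l x) \<partial>P) < \<infinity>"
proof -
  have "(\<integral>\<^sup>+x. ennreal (l x) \<partial>P) \<le> (\<integral>\<^sup>+x. ennreal (exp (l x)) \<partial>P)"
    by (intro nn_integral_mono ennreal_leI order.trans[OF _ exp_ge_add_one_self]) auto
  then show ?thesis
    by (simp add: nn_integral_exp_l order.strict_trans1)
qed

text \<open>Since \<open>- y \<le> exp (- y)\<close>, the integrand \<open>exp y * (- y)\<close> is
  at most 1. Hence the mean of \<open>l\<close> under \<open>Q\<close> is never an undefined
  difference of infinities.\<close>

lemma nn_integral_Q_uminus_l_finite: "(\<integral>\<^sup>+x. ennreal (- l x) \<partial>Q) < \<infinity>"
proof -
  have "(\<integral>\<^sup>+x. ennreal (- l x) \<partial>Q) = (\<integral>\<^sup>+x. ennreal (exp (l x)) * ennreal (- l x) \<partial>P)"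
    by (rule nn_integral_Q) auto
  also have "\<dots> \<le> (\<integral>\<^sup>+x. 1 \<partial>P)"
  proof (rule nn_integral_mono)
    fix x
    have "exp (l x) * (- l x) \<le> exp (l x) * exp (- l x)"
      using exp_ge_add_one_self[of "- l x"] by (intro mult_left_mono) auto
    then show "ennreal (exp (l x)) * ennreal (- l x) \<le> 1"
      by (simp flip: ennreal_mult' exp_add add: ennreal_le_1)
  qed
  finally show ?thesis
    by (simp add: emeasure_space_1 order.strict_trans1)
qed

text \<open>Convexity of exp between 0 and \<open>y\<close>. This makes the moments of order in
  [0, 1] finite and supplies the dominating function for the continuity of \<open>M\<close>.\<close>

lemma exp_mult_le: "0 \<le> z \<Longrightarrow> z \<le> 1 \<Longrightarrow> exp (z * y) \<le> (1 - z) + z * exp (y::real)"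
  using convex_onD[OF exp_convex, of z 0 y] by simp

lemma integrable_exp_l: "integrable P (\<lambda>x. exp (l x))"
  by (rule integrableI_nonneg) (auto simp: nn_integral_exp_l)

lemma M_0 [simp]: "M 0 = 1"
  by (simp add: M_def prob_space)

lemma M_1 [simp]: "M 1 = 1"
proof -
  have "ennreal (M 1) = 1"
    using nn_integral_eq_integral[OF integrable_exp_l] by (simp add: M_def nn_integral_exp_l)
  then show ?thesis by simp
qed

lemma integrable_exp_mult_l: "0 \<le> z \<Longrightarrow> z \<le> 1 \<Longrightarrow> integrable P (\<lambda>x. exp (z * l x))"
  by (rule Bochner_Integration.integrable_bound[of _ "\<lambda>x. (1 - z) + z * exp (l x)"])
     (auto simp: integrable_exp_l exp_mult_le intro!: AE_I2 order.trans[OF exp_mult_le])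

lemma emgf_eq_M: "0 \<le> z \<Longrightarrow> z \<le> 1 \<Longrightarrow> emgf z = ennreal (M z)"
  unfolding emgf_def M_def by (intro nn_integral_eq_integral integrable_exp_mult_l) auto

lemma M_pos:
  assumes "0 \<le> z" "z \<le> 1" shows "0 < M z"
proof (rule ccontr)
  assume "\<not> 0 < M z"
  then have "(\<integral>x. exp (z * l x) \<partial>P) = 0"
    unfolding M_def by (intro antisym) auto
  then have "AE x in P. exp (z * l x) = 0"
    by (subst (asm) integral_nonneg_eq_0_iff_AE[OF integrable_exp_mult_l[OF assms]]) auto
  then show False by simp
qed

text \<open>\<open>M (1/2)\<close> is the Hellinger affinity of the two laws: the integral of
  \<open>(exp (l x / 2) - 1)\<^sup>2\<close> is \<open>2 - 2 * M (1/2)\<close>. If it vanished,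
  \<open>l\<close> would be 0 almost surely, against separation.\<close>

lemma M_half_less_1: "M (1/2) < 1"
proof (rule ccontr)
  assume *: "\<not> M (1/2) < 1"
  define d where "d = (\<lambda>x. (exp (1/2 * l x) - 1)\<^sup>2)"
  have d_eq: "d x = exp (l x) - 2 * exp (1/2 * l x) + 1" for x
    by (simp add: d_def power2_diff flip: exp_double)
  have int: "integrable P d"
    unfolding d_eq using integrable_exp_l integrable_exp_mult_l[of "1/2"] by auto
  have "(\<integral>x. d x \<partial>P) = M 1 - 2 * M (1/2) + 1"
    unfolding d_eq using integrable_exp_l integrable_exp_mult_l[of "1/2"] by (simp add: M_def prob_space)
  also have "\<dots> \<le> 0"
    using * by simp
  finally have "(\<integral>x. d x \<partial>P) = 0"
    by (intro antisym) (auto simp: d_def)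
  then have "AE x in P. d x = 0"
    by (subst (asm) integral_nonneg_eq_0_iff_AE[OF int]) (auto simp: d_def)
  then have "AE x in P. l x = 0"
    by eventually_elim (auto simp: d_def)
  then have "eexpectation P (\<lambda>x. - l x) = eexpectation P (\<lambda>x. 0)"
    unfolding eexpectation_def
    by (intro arg_cong2[where f="(-)"] arg_cong[where f=enn2ereal] nn_integral_cong_AE) auto
  also have "\<dots> = 0"
    by (simp add: eexpectation_def)
  finally show False
    using separated by simp
qed

lemma eexpectation_l_neg: "eexpectation P l < 0"
proof -
  have "eexpectation P (\<lambda>x. - (- l x)) = - eexpectation P (\<lambda>x. - l x)"
    by (rule eexpectation_uminus) (use nn_integral_l_finite in simp)
  then show ?thesis
    using separated by (simp add: ereal_uminus_less_reorder)
qed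

text \<open>Gibbs' inequality, from \<open>exp (- l / 2) \<ge> 1 - l / 2\<close>.\<close>

lemma eexpectation_Q_l_pos: "0 < eexpectation Q l"
proof (cases "(\<integral>\<^sup>+x. ennreal (l x) \<partial>Q) = \<infinity>")
  case True
  then show ?thesis
    using eexpectation_eq_infinity[OF True] nn_integral_Q_uminus_l_finite by simp
next
  case False
  interpret Q: prob_space Q by (rule prob_space_Q)
  have int: "integrable Q l"
    by (rule integrable_if_nn_integrals_finite[OF _ False nn_integral_Q_uminus_l_finite]) simp
  have emgf: "(\<integral>\<^sup>+x. ennreal (exp ((-1/2) * l x)) \<partial>Q) = ennreal (M (1/2))"
    by (subst emgf_Q) (simp add: emgf_eq_M)
  then have int': "integrable Q (\<lambda>x. exp ((-1/2) * l x))"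
    by (intro integrableI_nonneg) auto
  have "ennreal (\<integral>x. exp ((-1/2) * l x) \<partial>Q) = ennreal (M (1/2))"
    using nn_integral_eq_integral[OF int'] emgf by simp
  then have "(\<integral>x. exp ((-1/2) * l x) \<partial>Q) = M (1/2)"
    using M_pos[of "1/2"] by (subst (asm) ennreal_inj) auto
  then have "(\<integral>x. exp ((-1/2) * l x) \<partial>Q) < 1"
    using M_half_less_1 by simp
  moreover have "(\<integral>x. 1 + (-1/2) * l x \<partial>Q) \<le> (\<integral>x. exp ((-1/2) * l x) \<partial>Q)"
    using int int' by (intro integral_mono exp_ge_add_one_self) auto
  moreover have "(\<integral>x. 1 + (-1/2) * l x \<partial>Q) = 1 + (-1/2) * (\<integral>x. l x \<partial>Q)"
    using int by (simp add: Q.prob_space)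
  ultimately show ?thesis
    by (simp add: eexpectation_eq_integral[OF int])
qed

lemma continuous_on_M: "continuous_on {0..1} M"
  unfolding continuous_on_sequentially
proof safe
  fix u :: "nat \<Rightarrow> real" and z
  assume u: "\<forall>n. u n \<in> {0..1}" "u \<longlonglongrightarrow> z"
  have "(\<lambda>n. \<integral>x. exp (u n * l x) \<partial>P) \<longlonglongrightarrow> (\<integral>x. exp (z * l x) \<partial>P)"
  proof (rule integral_dominated_convergence[where w="\<lambda>x. 1 + exp (l x)"])
    show "AE x in P. (\<lambda>n. exp (u n * l x)) \<longlonglongrightarrow> exp (z * l x)"
      using u(2) by (intro AE_I2 tendsto_intros)
    show "AE x in P. norm (exp (u n * l x)) \<le> 1 + exp (l x)" for n
    proof (intro AE_I2)
      fix x
      have "exp (u n * l x) \<le> (1 - u n) + u n * exp (l x)"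
        using u(1) by (intro exp_mult_le) auto
      also have "\<dots> \<le> 1 + exp (l x)"
        using u(1) by (intro add_mono mult_left_le_one_le) auto
      finally show "norm (exp (u n * l x)) \<le> 1 + exp (l x)" by simp
    qed
  qed (auto simp: integrable_exp_l)
  then show "(M \<circ> u) \<longlonglongrightarrow> M z"
    by (simp add: M_def comp_def)
qed

text \<open>Jensen's inequality at level 0, once under each law. For negative \<open>w\<close> it is
  applied under \<open>P\<close>, where \<open>- l\<close> has positive mean; for \<open>w\<close>
  above 1, \<open>emgf w\<close> is the moment of order \<open>w - 1\<close> under \<open>Q\<close>,
  where \<open>l\<close> has positive mean.\<close>

lemma one_le_emgf:
  assumes "w < 0 \<or> 1 < w" shows "1 \<le> emgf w"
  using assms
proof
  assume "w < 0"
  have "ennreal (exp (- w * 0)) \<le> (\<integral>\<^sup>+x. ennreal (exp (- w * - l x)) \<partial>P)"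
    using \<open>w < 0\<close> nn_integral_l_finite separated
    by (intro exp_moment_ge prob_space_axioms) (auto simp: zero_ereal_def)
  then show ?thesis by (simp add: emgf_def)
next
  assume "1 < w"
  have "ennreal (exp ((w - 1) * 0)) \<le> (\<integral>\<^sup>+x. ennreal (exp ((w - 1) * l x)) \<partial>Q)"
    using \<open>1 < w\<close> nn_integral_Q_uminus_l_finite eexpectation_Q_l_pos
    by (intro exp_moment_ge prob_space_Q) (auto simp: zero_ereal_def)
  then show ?thesis by (simp add: emgf_Q)
qed

text \<open>Continuity gives a minimizer on [0, 1]. Its value is at most
  \<open>M (1/2) < 1 = M 0 = M 1\<close>, which excludes the endpoints, and outside [0, 1]
  \<open>emgf\<close> is at least 1.\<close>

lemma ex_minimizer: "\<exists>z. 0 < z \<and> z < 1 \<and> (\<forall>w. ennreal (M z) \<le> emgf w)"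
proof -
  obtain z where z: "z \<in> {0..1}" "\<And>w. w \<in> {0..1} \<Longrightarrow> M z \<le> M w"
    using continuous_attains_inf[OF _ _ continuous_on_M] by auto
  have "M z < 1"
    using z(2)[of "1/2"] M_half_less_1 by simp
  then have "z \<noteq> 0" "z \<noteq> 1"
    using M_0 M_1 by (metis less_irrefl)+
  moreover have "ennreal (M z) \<le> emgf w" for w
  proof (cases "w \<in> {0..1}")
    case True
    then show ?thesis using z by (auto simp: emgf_eq_M intro!: ennreal_leI)
  next
    case False
    have "ennreal (M z) \<le> 1" using \<open>M z < 1\<close> by (simp add: ennreal_le_1)
    also have "1 \<le> emgf w" using False by (intro one_le_emgf) auto
    finally show ?thesis .
  qed
  ultimately show ?thesis
    using z by (intro exI[of _ z]) auto
qed

definition zmin :: real where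
  "zmin = (SOME z. 0 < z \<and> z < 1 \<and> (\<forall>w. ennreal (M z) \<le> emgf w))"

lemma zmin: "0 < zmin" "zmin < 1" "\<And>w. ennreal (M zmin) \<le> emgf w"
  using someI_ex[OF ex_minimizer] unfolding zmin_def by auto

text \<open>This is the Chernoff index of the pair, as \<open>chernoff_index_eq\<close>
  confirms.\<close>

definition c :: real where
  "c = - ln (M zmin)"

lemma M_zmin: "M zmin = exp (- c)"
  using M_pos[of zmin] zmin by (simp add: c_def)

lemma c_nonneg: "0 \<le> c"
proof -
  have "ennreal (M zmin) \<le> 1"
    using zmin(3)[of 0] emgf_eq_M[of 0] by simp
  then show ?thesis
    by (simp add: M_zmin ennreal_le_1)
qed

text \<open>Turns a lower bound on a moment, possibly infinite, into an upper bound on a term of the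
  rate function.\<close>

lemma minus_elog_le: "ennreal (exp a) \<le> X \<Longrightarrow> ereal b - elog X \<le> ereal (b - a)"
  using elog_mono[of "ennreal (exp a)" X] ereal_minus_mono[of "ereal b" "ereal b" "ereal a" "elog X"] by simp

text \<open>For nonnegative \<open>t\<close> the rate function of h at \<open>- t\<close> is at most
  \<open>c\<close>, for negative \<open>t\<close> that of g at \<open>t\<close>. In both cases
  exponents \<open>z \<ge> 0\<close> are handled by the global minimum \<open>exp (- c)\<close> of
  \<open>emgf\<close>, and exponents \<open>z < 0\<close> by Jensen's inequality, which makes the
  term nonpositive because \<open>t\<close> lies between the two means. Equality is reached at
  \<open>t = 0\<close>.\<close>

lemma chernoff_index_eq:
  assumes P: "P = law \<mu> g" and l: "l = loglr g h" and Q: "law \<mu> h = Q"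
  shows "chernoff_index \<mu> g h = ereal c"
proof (rule antisym)
  have mgf_g: "mgf \<mu> g h z = emgf z" for z
    by (simp add: mgf_def emgf_def P[symmetric] l[symmetric])
  \<comment> \<open>Under \<open>Q\<close> the density \<open>exp (l x)\<close> raises the exponent
    by one, so the moment generating function for h is that for g reflected about 1/2.\<close>
  have mgf_h: "mgf \<mu> h g z = emgf (1 - z)" for z
  proof -
    have "z * loglr h g x = - z * l x" for x
      by (simp add: l loglr_def algebra_simps)
    then have "mgf \<mu> h g z = (\<integral>\<^sup>+x. ennreal (exp (- z * l x)) \<partial>Q)"
      by (simp add: mgf_def Q)
    then show ?thesis by (simp only: emgf_Q) simp
  qed
  have min: "ennreal (exp (- c)) \<le> emgf w" for w
    using zmin(3) by (simp add: M_zmin)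
  show "chernoff_index \<mu> g h \<le> ereal c"
    unfolding chernoff_index_def
  proof (rule SUP_least)
    fix t
    assume "t \<in> {t. eexpectation (law \<mu> g) (loglr g h) < ereal t \<and> ereal t < eexpectation (law \<mu> h) (loglr g h)}"
    then have tP: "eexpectation P l < ereal t" and tQ: "ereal t < eexpectation Q l"
      by (simp_all add: P[symmetric] l[symmetric] Q)
    show "min (rate_fun \<mu> g h t) (rate_fun \<mu> h g (- t)) \<le> ereal c"
    proof (cases "0 \<le> t")
      case True
      have "rate_fun \<mu> h g (- t) \<le> ereal c"
        unfolding rate_fun_def mgf_h
      proof (rule SUP_least)
        fix z :: real
        show "ereal (z * - t) - elog (emgf (1 - z)) \<le> ereal c"
        proof (cases "0 \<le> z")
          case z: True
          have "ereal (z * - t) - elog (emgf (1 - z)) \<le> ereal (z * - t - (- c))"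
            by (rule minus_elog_le[OF min])
          also have "\<dots> \<le> ereal c"
            using z True by simp
          finally show ?thesis .
        next
          case False
          have "ennreal (exp ((- z) * t)) \<le> (\<integral>\<^sup>+x. ennreal (exp ((- z) * l x)) \<partial>Q)"
            using False nn_integral_Q_uminus_l_finite tQ
            by (intro exp_moment_ge prob_space_Q) auto
          then have "ennreal (exp ((- z) * t)) \<le> emgf (1 - z)"
            by (simp only: emgf_Q) simp
          then have "ereal (z * - t) - elog (emgf (1 - z)) \<le> ereal (z * - t - (- z) * t)"
            by (rule minus_elog_le)
          then show ?thesis
            using c_nonneg by (auto elim!: order.trans)
        qed
      qed
      then show ?thesis by (rule min.coboundedI2)
    next
      case False
      have "rate_fun \<mu> g h t \<le> ereal c"
        unfolding rate_fun_def mgf_g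
      proof (rule SUP_least)
        fix z :: real
        show "ereal (z * t) - elog (emgf z) \<le> ereal c"
        proof (cases "0 \<le> z")
          case True
          have "ereal (z * t) - elog (emgf z) \<le> ereal (z * t - (- c))"
            by (rule minus_elog_le[OF min])
          also have "\<dots> \<le> ereal c"
            using True False by (simp add: mult_nonneg_nonpos)
          finally show ?thesis .
        next
          case z: False
          have "eexpectation P (\<lambda>x. - (- l x)) = - eexpectation P (\<lambda>x. - l x)"
            by (rule eexpectation_uminus) (use nn_integral_l_finite in simp)
          then have "ereal (- t) < eexpectation P (\<lambda>x. - l x)"
            using tP by (cases "eexpectation P (\<lambda>x. - l x)") auto
          then have "ennreal (exp ((- z) * (- t))) \<le> (\<integral>\<^sup>+x. ennreal (exp ((- z) * - l x)) \<partial>P)"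
            using z nn_integral_l_finite
            by (intro exp_moment_ge prob_space_axioms) auto
          then have "ennreal (exp (z * t)) \<le> emgf z"
            by (simp add: emgf_def)
          then have "ereal (z * t) - elog (emgf z) \<le> ereal (z * t - z * t)"
            by (rule minus_elog_le)
          then show ?thesis
            using c_nonneg by (auto elim!: order.trans)
        qed
      qed
      then show ?thesis by (rule min.coboundedI1)
    qed
  qed
  have elog_c: "elog (emgf zmin) = ereal (- c)"
    using zmin by (simp add: emgf_eq_M M_zmin)
  \<comment> \<open>The level 0 is admissible because \<open>l\<close> has negative mean under
    \<open>P\<close> and positive mean under \<open>Q\<close>; the reflection sends the optimal
    exponent \<open>zmin\<close> to \<open>1 - zmin\<close>.\<close>
  have "ereal c \<le> rate_fun \<mu> g h 0"
    unfolding rate_fun_def mgf_g by (rule SUP_upper2[of zmin]) (auto simp: elog_c)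
  moreover have "ereal c \<le> rate_fun \<mu> h g (- 0)"
    unfolding rate_fun_def mgf_h by (rule SUP_upper2[of "1 - zmin"]) (auto simp: elog_c)
  ultimately show "ereal c \<le> chernoff_index \<mu> g h"
    unfolding chernoff_index_def using eexpectation_l_neg eexpectation_Q_l_pos
    by (intro SUP_upper2[of 0]) (simp_all add: P[symmetric] l[symmetric] Q zero_ereal_def[symmetric])
qed

end

section \<open>Large deviation estimates\<close>

text \<open>It suffices to compare the two measures on rectangles, where the indicator factorizes
  along with the density and the integral becomes a product. It is used to write the n-fold laws of
  h and of the tilting as densities with respect to that of g.\<close>

lemma PiM_density:
  assumes P: "prob_space P" and f [measurable]: "f \<in> borel_measurable P"
    and D: "prob_space (density P f)" and I: "finite I"
  shows "PiM I (\<lambda>_. density P f) = density (PiM I (\<lambda>_. P)) (\<lambda>x. \<Prod>i\<in>I. f (x i))"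
proof -
  interpret P: prob_space P by fact
  interpret D: prob_space "density P f" by fact
  interpret PP: product_sigma_finite "\<lambda>_. P" by standard
  interpret DD: product_sigma_finite "\<lambda>_. density P f" by standard
  show ?thesis
  proof (rule DD.PiM_eqI[symmetric])
    show "sets (density (PiM I (\<lambda>_. P)) (\<lambda>x. \<Prod>i\<in>I. f (x i))) = sets (PiM I (\<lambda>_. density P f))"
      by (simp, intro sets_PiM_cong) auto
  next
    fix A assume A: "\<And>i. i \<in> I \<Longrightarrow> A i \<in> sets (density P f)"
    then have [measurable]: "i \<in> I \<Longrightarrow> A i \<in> sets P" for i by simp
    have PiE: "Pi\<^sub>E I A \<in> sets (PiM I (\<lambda>_. P))"
      using I by (intro sets_PiM_I_finite) auto
    have "emeasure (density (PiM I (\<lambda>_. P)) (\<lambda>x. \<Prod>i\<in>I. f (x i))) (Pi\<^sub>E I A) =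
        (\<integral>\<^sup>+x. (\<Prod>i\<in>I. f (x i)) * indicator (Pi\<^sub>E I A) x \<partial>PiM I (\<lambda>_. P))"
      using PiE by (intro emeasure_density) auto
    also have "\<dots> = (\<integral>\<^sup>+x. (\<Prod>i\<in>I. f (x i) * indicator (A i) (x i)) \<partial>PiM I (\<lambda>_. P))"
    proof (rule nn_integral_cong)
      fix x assume x: "x \<in> space (PiM I (\<lambda>_. P))"
      have "indicator (Pi\<^sub>E I A) x = (\<Prod>i\<in>I. indicator (A i) (x i) :: ennreal)"
      proof (cases "x \<in> Pi\<^sub>E I A")
        case True
        then show ?thesis by (simp add: PiE_iff)
      next
        case False
        then obtain i where "i \<in> I" "x i \<notin> A i"
          using x by (auto simp: space_PiM PiE_iff)
        then have "(\<Prod>i\<in>I. indicator (A i) (x i) :: ennreal) = 0"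
          using I by (intro prod_zero bexI[of _ i]) auto
        with False show ?thesis by simp
      qed
      then show "(\<Prod>i\<in>I. f (x i)) * indicator (Pi\<^sub>E I A) x = (\<Prod>i\<in>I. f (x i) * indicator (A i) (x i))"
        by (simp add: prod.distrib)
    qed
    also have "\<dots> = (\<Prod>i\<in>I. \<integral>\<^sup>+x. f x * indicator (A i) x \<partial>P)"
      using I by (intro PP.product_nn_integral_prod) auto
    also have "\<dots> = (\<Prod>i\<in>I. emeasure (density P f) (A i))"
      by (intro prod.cong refl emeasure_density[symmetric]) auto
    finally show "emeasure (density (PiM I (\<lambda>_. P)) (\<lambda>x. \<Prod>i\<in>I. f (x i))) (Pi\<^sub>E I A) =
      (\<Prod>i\<in>I. emeasure (density P f) (A i))" .
  qed (rule I)
qed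

lemma PiM_density_exp:
  fixes u :: "'a \<Rightarrow> real"
  assumes "prob_space P" and [measurable]: "u \<in> borel_measurable P"
    and "prob_space (density P (\<lambda>x. ennreal (exp (u x))))"
  shows "PiM {..<n::nat} (\<lambda>_. density P (\<lambda>x. ennreal (exp (u x)))) =
    density (PiM {..<n} (\<lambda>_. P)) (\<lambda>x. ennreal (exp (\<Sum>i<n. u (x i))))"
  by (subst PiM_density[OF assms(1) _ assms(3)]) (auto simp: prod_ennreal exp_sum)

text \<open>Markov's inequality for the exponential of the sum, whose integral factorizes over the
  coordinates. Nonnegative integrals are used throughout, so an infinite moment merely makes the
  bound trivial.\<close>

lemma emeasure_PiM_sum_ge:
  fixes X :: "'a \<Rightarrow> real"
  assumes "prob_space N" and [measurable]: "X \<in> borel_measurable N" and s: "0 < s"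
  shows "emeasure (PiM {..<n} (\<lambda>_. N)) {x \<in> space (PiM {..<n} (\<lambda>_. N)). a \<le> (\<Sum>i<n. X (x i))}
    \<le> ennreal (exp (- s * a)) * (\<integral>\<^sup>+x. ennreal (exp (s * X x)) \<partial>N) ^ n"
proof -
  interpret N: prob_space N by fact
  interpret NN: product_sigma_finite "\<lambda>_::nat. N" by standard
  let ?N = "PiM {..<n} (\<lambda>_. N)"
  have "emeasure ?N {x \<in> space ?N. a \<le> (\<Sum>i<n. X (x i))}
      \<le> ennreal (exp (- s * a)) * (\<integral>\<^sup>+x. ennreal (exp (s * (\<Sum>i<n. X (x i)))) * indicator (space ?N) x \<partial>?N)"
    using s by (intro Chernoff_ineq_nn_integral_ge) auto
  also have "(\<integral>\<^sup>+x. ennreal (exp (s * (\<Sum>i<n. X (x i)))) * indicator (space ?N) x \<partial>?N) =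
      (\<integral>\<^sup>+x. (\<Prod>i<n. ennreal (exp (s * X (x i)))) \<partial>?N)"
    by (intro nn_integral_cong) (simp add: prod_ennreal exp_sum sum_distrib_left)
  also have "\<dots> = (\<Prod>i<n. \<integral>\<^sup>+x. ennreal (exp (s * X x)) \<partial>N)"
    by (intro NN.product_nn_integral_prod) auto
  finally show ?thesis by simp
qed

lemma one_le_ennreal_imp_le: "1 \<le> ennreal x \<Longrightarrow> 1 \<le> x"
  by (metis ennreal_1 ennreal_le_iff2 not_one_le_zero)

lemma exp_le_quadratic: "exp x \<le> 1 + x + x\<^sup>2 * exp \<bar>x::real\<bar>"
proof -
  obtain t where t: "\<bar>t\<bar> \<le> \<bar>x\<bar>" "exp x = (\<Sum>m<2. x ^ m / fact m) + exp t / fact 2 * x ^ 2"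
    using Maclaurin_exp_le by blast
  have "exp t / fact 2 * x ^ 2 \<le> exp \<bar>x\<bar> * x ^ 2"
  proof (rule mult_right_mono)
    have "exp t \<le> exp \<bar>x\<bar>"
      unfolding exp_le_cancel_iff using t(1) by linarith
    moreover have "exp t / fact 2 \<le> exp t" by (simp add: fact_numeral)
    ultimately show "exp t / fact 2 \<le> exp \<bar>x\<bar>" by linarith
  qed simp
  then show ?thesis
    using t(2) by (simp add: numeral_2_eq_2 mult.commute)
qed

lemma exp_abs_le_add: "exp \<bar>x\<bar> \<le> exp x + exp (- x::real)"
  by (cases "0 \<le> x") auto

lemma square_le_exp:
  assumes "0 < d" shows "y\<^sup>2 \<le> 2 / d\<^sup>2 * exp (d * \<bar>y::real\<bar>)"
proof -
  have "1 + d * \<bar>y\<bar> + (d * \<bar>y\<bar>)\<^sup>2 / 2 \<le> exp (d * \<bar>y\<bar>)"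
    using assms by (intro exp_lower_Taylor_quadratic) auto
  moreover have "0 \<le> d * \<bar>y\<bar>"
    using assms by simp
  ultimately have "(d * \<bar>y\<bar>)\<^sup>2 / 2 \<le> exp (d * \<bar>y\<bar>)"
    by linarith
  then show ?thesis
    using assms by (simp add: field_simps power_mult_distrib)
qed

subsection \<open>Tilting\<close>

context chernoff_pair
begin

text \<open>The summand \<open>c\<close> normalizes: \<open>M zmin = exp (- c)\<close>.\<close>

definition tilted :: "real measure" where
  "tilted = density P (\<lambda>x. ennreal (exp (zmin * l x + c)))"

lemma sets_tilted [simp, measurable_cong]: "sets tilted = sets P"
  by (simp add: tilted_def)

lemma emgf_tilted: "(\<integral>\<^sup>+x. ennreal (exp (s * l x)) \<partial>tilted) = ennreal (exp c) * emgf (zmin + s)"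
proof -
  have "(\<integral>\<^sup>+x. ennreal (exp (s * l x)) \<partial>tilted) =
      (\<integral>\<^sup>+x. ennreal (exp (zmin * l x + c)) * ennreal (exp (s * l x)) \<partial>P)"
    unfolding tilted_def by (rule nn_integral_density) auto
  also have "\<dots> = (\<integral>\<^sup>+x. ennreal (exp c) * ennreal (exp ((zmin + s) * l x)) \<partial>P)"
    by (intro nn_integral_cong) (simp add: algebra_simps flip: ennreal_mult' exp_add)
  also have "\<dots> = ennreal (exp c) * emgf (zmin + s)"
    unfolding emgf_def by (rule nn_integral_cmult) auto
  finally show ?thesis .
qed

lemma prob_space_tilted: "prob_space tilted"
proof (rule prob_spaceI)
  have "emeasure tilted (space tilted) = (\<integral>\<^sup>+x. ennreal (exp (0 * l x)) \<partial>tilted)"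
    by simp
  also have "\<dots> = 1"
    using zmin by (subst emgf_tilted) (simp add: emgf_eq_M M_zmin exp_minus flip: ennreal_mult')
  finally show "emeasure tilted (space tilted) = 1" .
qed

text \<open>Global minimality of \<open>zmin\<close>, read under the tilted law: its moment
  generating function is \<open>emgf\<close> shifted by \<open>zmin\<close> and scaled, so its
  minimum is the value 1 at \<open>s = 0\<close>.\<close>

lemma one_le_emgf_tilted: "1 \<le> (\<integral>\<^sup>+x. ennreal (exp (s * l x)) \<partial>tilted)"
proof -
  have "1 = ennreal (exp c) * ennreal (exp (- c))"
    by (simp add: exp_minus flip: ennreal_mult')
  also have "\<dots> \<le> ennreal (exp c) * emgf (zmin + s)"
    using zmin(3) by (intro mult_left_mono) (auto simp: M_zmin)
  finally show ?thesis by (simp add: emgf_tilted)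
qed

text \<open>The tilted law has mean log-likelihood ratio 0, since \<open>zmin\<close> is an interior minimizer;
  hence its moment generating function is \<open>1 + O(s\<^sup>2)\<close>.\<close>

lemma emgf_tilted_le:
  obtains d K where "0 < d" "0 < K"
    "\<And>s. \<bar>s\<bar> \<le> d \<Longrightarrow> (\<integral>\<^sup>+x. ennreal (exp (s * l x)) \<partial>tilted) \<le> ennreal (1 + K * s\<^sup>2)"
proof -
  interpret T: prob_space tilted by (rule prob_space_tilted)
  \<comment> \<open>The distance from \<open>zmin\<close> to the endpoints of [0, 1]: as long as
    \<open>s\<close> stays within it, \<open>zmin + s\<close> is an order at which moments are
    finite.\<close>
  define d0 where "d0 = min zmin (1 - zmin)"
  have d0: "0 < d0" using zmin by (auto simp: d0_def)
  have int: "integrable tilted (\<lambda>x. exp (s * l x))" if "\<bar>s\<bar> \<le> d0" for s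
  proof (rule integrableI_nonneg)
    have "(\<integral>\<^sup>+x. ennreal (exp (s * l x)) \<partial>tilted) = ennreal (exp c) * ennreal (M (zmin + s))"
      using that zmin by (subst emgf_tilted, subst emgf_eq_M) (auto simp: d0_def)
    then show "(\<integral>\<^sup>+x. ennreal (exp (s * l x)) \<partial>tilted) < \<infinity>"
      by (simp flip: ennreal_mult')
  qed auto
  \<comment> \<open>Only half of the admissible range is used for \<open>s\<close>. The other half
    absorbs the factor \<open>(l x)\<^sup>2\<close> of the remainder, which gives the integrable
    bound \<open>w\<close>.\<close>
  define d where "d = d0 / 2"
  have d: "0 < d" using d0 by (simp add: d_def)
  define w where "w x = 2 / d\<^sup>2 * (exp (d0 * l x) + exp (- d0 * l x))" for x
  have w_int: "integrable tilted w"
    unfolding w_def using int[of d0] int[of "- d0"] d0 by auto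
  have w: "(l x)\<^sup>2 * exp (d * \<bar>l x\<bar>) \<le> w x" for x
  proof -
    have "(l x)\<^sup>2 * exp (d * \<bar>l x\<bar>) \<le> 2 / d\<^sup>2 * exp (d * \<bar>l x\<bar>) * exp (d * \<bar>l x\<bar>)"
      by (intro mult_right_mono square_le_exp d) auto
    also have "\<dots> = 2 / d\<^sup>2 * exp \<bar>d0 * l x\<bar>"
      using d0 by (simp add: d_def abs_mult flip: exp_add)
    also have "\<dots> \<le> w x"
      unfolding w_def using exp_abs_le_add[of "d0 * l x"] by (intro mult_left_mono) auto
    finally show ?thesis .
  qed
  have w_nonneg: "0 \<le> w x" for x
    by (simp add: w_def)
  have l_int: "integrable tilted l"
  proof (rule Bochner_Integration.integrable_bound)
    show "integrable tilted (\<lambda>x. 1 + w x)" using w_int by simp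
    show "AE x in tilted. norm (l x) \<le> norm (1 + w x)"
    proof (rule AE_I2)
      fix x
      have "\<bar>l x\<bar> \<le> 1 + (l x)\<^sup>2"
        using sum_squares_bound[of "\<bar>l x\<bar>" 1] zero_le_power2[of "l x"]
        by (simp only: power2_abs one_power2 mult_1_right)
      also have "(l x)\<^sup>2 \<le> (l x)\<^sup>2 * exp (d * \<bar>l x\<bar>)"
        using d by (simp add: mult_le_cancel_left1 one_le_exp_iff)
      also have "\<dots> \<le> w x" by (rule w)
      finally show "norm (l x) \<le> norm (1 + w x)" by simp
    qed
  qed simp
  define K where "K = (\<integral>x. w x \<partial>tilted) + 1"
  have "0 < K" using w_nonneg by (simp add: K_def add_nonneg_pos)
  define m where "m s = (\<integral>x. exp (s * l x) \<partial>tilted)" for s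
  have m: "(\<integral>\<^sup>+x. ennreal (exp (s * l x)) \<partial>tilted) = ennreal (m s)" if "\<bar>s\<bar> \<le> d" for s
    unfolding m_def using that d by (intro nn_integral_eq_integral int) (auto simp: d_def)
  have m_ge: "1 \<le> m s" if "\<bar>s\<bar> \<le> d" for s
    using one_le_emgf_tilted[of s] m[OF that] by (intro one_le_ennreal_imp_le) simp
  have m_le: "m s \<le> 1 + s * (\<integral>x. l x \<partial>tilted) + K * s\<^sup>2" if "\<bar>s\<bar> \<le> d" for s
  proof -
    have "m s \<le> (\<integral>x. 1 + s * l x + s\<^sup>2 * w x \<partial>tilted)"
      unfolding m_def
    proof (rule integral_mono)
      fix x
      have "exp (s * l x) \<le> 1 + s * l x + (s * l x)\<^sup>2 * exp \<bar>s * l x\<bar>"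
        by (rule exp_le_quadratic)
      also have "(s * l x)\<^sup>2 * exp \<bar>s * l x\<bar> \<le> s\<^sup>2 * ((l x)\<^sup>2 * exp (d * \<bar>l x\<bar>))"
        using that by (simp add: power_mult_distrib mult.assoc abs_mult)
          (intro mult_left_mono, auto intro!: mult_right_mono)
      also have "\<dots> \<le> s\<^sup>2 * w x"
        by (intro mult_left_mono w) auto
      finally show "exp (s * l x) \<le> 1 + s * l x + s\<^sup>2 * w x" by simp
    qed (use that d l_int w_int int in \<open>auto simp: d_def\<close>)
    also have "\<dots> = 1 + s * (\<integral>x. l x \<partial>tilted) + s\<^sup>2 * (\<integral>x. w x \<partial>tilted)"
      using l_int w_int by (simp add: T.prob_space)
    also have "\<dots> \<le> 1 + s * (\<integral>x. l x \<partial>tilted) + K * s\<^sup>2"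
      by (simp add: K_def algebra_simps)
    finally show ?thesis .
  qed
  define e where "e = (\<integral>x. l x \<partial>tilted)"
  have "e = 0"
  proof (rule ccontr)
    assume "e \<noteq> 0"
    \<comment> \<open>Moving from 0 by \<open>t\<close> against the sign of \<open>e\<close> changes
      the second-order bound by \<open>- t * \<bar>e\<bar> + K * t\<^sup>2\<close>. The choice makes
      \<open>K * t\<close> at most half of \<open>\<bar>e\<bar>\<close>, so this is negative,
      although the moment generating function is at least 1.\<close>
    define t where "t = min d (\<bar>e\<bar> / (2 * K))"
    have t: "0 < t" "t \<le> d" "t * K \<le> \<bar>e\<bar> / 2"
      using \<open>e \<noteq> 0\<close> \<open>0 < K\<close> d by (auto simp: t_def min_def field_simps)
    have "\<bar>- sgn e * t\<bar> \<le> d"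
      using t \<open>e \<noteq> 0\<close> by (simp add: abs_mult)
    from order.trans[OF m_ge[OF this] m_le[OF this]]
    have "1 \<le> 1 + (- sgn e * t) * e + K * (- sgn e * t)\<^sup>2"
      by (simp only: e_def)
    also have "\<dots> = 1 - t * \<bar>e\<bar> + K * t\<^sup>2"
      using \<open>e \<noteq> 0\<close> by (simp add: sgn_if)
    finally have "t * \<bar>e\<bar> \<le> t * (t * K)"
      by (simp add: power2_eq_square algebra_simps)
    then have "\<bar>e\<bar> \<le> t * K"
      using t(1) by simp
    with t(3) \<open>e \<noteq> 0\<close> show False by simp
  qed
  show ?thesis
  proof (rule that[of d K])
    fix s assume "\<bar>s\<bar> \<le> d"
    then show "(\<integral>\<^sup>+x. ennreal (exp (s * l x)) \<partial>tilted) \<le> ennreal (1 + K * s\<^sup>2)"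
      using m_le[of s] \<open>e = 0\<close> by (simp add: m e_def ennreal_leI)
  qed fact+
qed

lemma tilted_concentration:
  assumes "0 < \<epsilon>"
  obtains r where "0 < r"
    "\<And>n::nat. emeasure (PiM {..<n} (\<lambda>_. tilted)) {x \<in> space (PiM {..<n} (\<lambda>_. P)). real n * \<epsilon> \<le> \<bar>\<Sum>i<n. l (x i)\<bar>}
      \<le> ennreal (2 * exp (- r * real n))"
proof -
  obtain d K where d: "0 < d" and K: "0 < K" and
    le: "\<And>s. \<bar>s\<bar> \<le> d \<Longrightarrow> (\<integral>\<^sup>+x. ennreal (exp (s * l x)) \<partial>tilted) \<le> ennreal (1 + K * s\<^sup>2)"
    using emgf_tilted_le by blast
  \<comment> \<open>Chernoff's bound per observation is \<open>- s * \<epsilon>\<close> plus at most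
    \<open>K * s\<^sup>2\<close>. With \<open>K * s\<close> at most \<open>\<epsilon> / 2\<close>,
    half of the gain survives as the rate \<open>r\<close>; the sign \<open>\<sigma>\<close> below
    treats both tails together.\<close>
  define s where "s = min d (\<epsilon> / (2 * K))"
  have s: "0 < s" "s \<le> d" "K * s \<le> \<epsilon> / 2"
    using assms K d by (auto simp: s_def min_def field_simps)
  define r where "r = s * \<epsilon> / 2"
  have r: "0 < r" using s assms by (simp add: r_def)
  have le': "(\<integral>\<^sup>+x. ennreal (exp (s' * l x)) \<partial>tilted) \<le> ennreal (exp r)" if "\<bar>s'\<bar> = s" for s'
  proof -
    have "K * s'\<^sup>2 = (K * s) * s"
      using that by (metis power2_abs power2_eq_square mult.assoc)
    also have "\<dots> \<le> (\<epsilon> / 2) * s"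
      using s by (intro mult_right_mono) auto
    finally have "1 + K * s'\<^sup>2 \<le> 1 + r"
      by (simp add: r_def mult.commute)
    also have "\<dots> \<le> exp r"
      by (rule exp_ge_add_one_self)
    finally have "1 + K * s'\<^sup>2 \<le> exp r" .
    then show ?thesis
      using le[of s'] that s by (auto intro: order.trans ennreal_leI)
  qed
  have tail: "emeasure (PiM {..<n} (\<lambda>_. tilted)) {x \<in> space (PiM {..<n} (\<lambda>_. tilted)). real n * \<epsilon> \<le> (\<Sum>i<n. \<sigma> * l (x i))}
      \<le> ennreal (exp (- r * real n))" if "\<bar>\<sigma>\<bar> = 1" for \<sigma> :: real and n :: nat
  proof -
    have "emeasure (PiM {..<n} (\<lambda>_. tilted)) {x \<in> space (PiM {..<n} (\<lambda>_. tilted)). real n * \<epsilon> \<le> (\<Sum>i<n. \<sigma> * l (x i))}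
      \<le> ennreal (exp (- s * (real n * \<epsilon>))) * (\<integral>\<^sup>+x. ennreal (exp (s * (\<sigma> * l x))) \<partial>tilted) ^ n"
      using s by (intro emeasure_PiM_sum_ge prob_space_tilted) auto
    also have "\<dots> \<le> ennreal (exp (- s * (real n * \<epsilon>))) * ennreal (exp r) ^ n"
      using le'[of "s * \<sigma>"] that s
      by (intro mult_left_mono power_mono) (auto simp: abs_mult mult.assoc)
    also have "\<dots> = ennreal (exp (- r * real n))"
      by (simp add: ennreal_power r_def flip: ennreal_mult' exp_of_nat_mult exp_add)
    finally show ?thesis .
  qed
  have space: "space (PiM {..<n} (\<lambda>_. tilted)) = space (PiM {..<n} (\<lambda>_. P))" for n::nat
    by (simp add: space_PiM tilted_def)
  show ?thesis
  proof (rule that[OF r])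
    fix n :: nat
    let ?T = "PiM {..<n} (\<lambda>_. tilted)"
    let ?A = "\<lambda>\<sigma>. {x \<in> space ?T. real n * \<epsilon> \<le> (\<Sum>i<n. \<sigma> * l (x i))}"
    have "emeasure ?T {x \<in> space (PiM {..<n} (\<lambda>_. P)). real n * \<epsilon> \<le> \<bar>\<Sum>i<n. l (x i)\<bar>}
        \<le> emeasure ?T (?A 1 \<union> ?A (- 1))"
      by (intro emeasure_mono) (auto simp: space sum_negf)
    also have "\<dots> \<le> emeasure ?T (?A 1) + emeasure ?T (?A (- 1))"
      by (intro emeasure_subadditive) auto
    also have "\<dots> \<le> ennreal (exp (- r * real n)) + ennreal (exp (- r * real n))"
      by (intro add_mono tail) auto
    finally show "emeasure ?T {x \<in> space (PiM {..<n} (\<lambda>_. P)). real n * \<epsilon> \<le> \<bar>\<Sum>i<n. l (x i)\<bar>}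
        \<le> ennreal (2 * exp (- r * real n))"
      by (simp flip: ennreal_plus)
  qed
qed

text \<open>Change of measure. On the set \<open>A\<close>, where the log-likelihood ratio sum is
  smaller than \<open>n * \<epsilon>\<close>, the tilted law has density at most
  \<open>k = exp (n * (c + \<epsilon>))\<close> with respect to both product laws. Splitting
  \<open>A\<close> by \<open>C\<close> therefore bounds its tilted mass by \<open>k\<close> times
  the sum of the two errors, while that mass is at least 1/2 from some n on, independently of
  \<open>C\<close>.\<close>

lemma sum_of_errors_ge:
  assumes \<epsilon>: "0 < \<epsilon>"
  shows "\<forall>\<^sub>F n in sequentially. \<forall>C \<in> sets (PiM {..<n} (\<lambda>_. P)).
    ennreal (exp (- (real n * (c + \<epsilon>))) / 2)
      \<le> emeasure (PiM {..<n} (\<lambda>_. P)) C + emeasure (PiM {..<n} (\<lambda>_. Q)) (space (PiM {..<n} (\<lambda>_. P)) - C)"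
proof -
  obtain r where r: "0 < r" and conc:
    "\<And>n::nat. emeasure (PiM {..<n} (\<lambda>_. tilted)) {x \<in> space (PiM {..<n} (\<lambda>_. P)). real n * \<epsilon> \<le> \<bar>\<Sum>i<n. l (x i)\<bar>}
      \<le> ennreal (2 * exp (- r * real n))"
    using tilted_concentration[OF \<epsilon>] by blast
  have "\<forall>\<^sub>F n in sequentially. 2 * exp (- r * real n) < 1 / 2"
    using r by real_asymp
  then show ?thesis
  proof eventually_elim
    case (elim n)
    let ?P = "PiM {..<n} (\<lambda>_. P)" and ?Q = "PiM {..<n} (\<lambda>_. Q)" and ?T = "PiM {..<n} (\<lambda>_. tilted)"
    define S where "S x = (\<Sum>i<n. l (x i))" for x
    have [measurable]: "S \<in> borel_measurable ?P"
      by (simp add: S_def[abs_def])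
    have Q: "?Q = density ?P (\<lambda>x. ennreal (exp (S x)))"
      unfolding Q_def S_def
      by (rule PiM_density_exp) (use prob_space_axioms prob_space_Q[unfolded Q_def] in auto)
    have "?T = density ?P (\<lambda>x. ennreal (exp (\<Sum>i<n. zmin * l (x i) + c)))"
      unfolding tilted_def
      by (rule PiM_density_exp) (use prob_space_axioms prob_space_tilted[unfolded tilted_def] in auto)
    then have T: "?T = density ?P (\<lambda>x. ennreal (exp (zmin * S x + real n * c)))"
      by (simp add: S_def sum.distrib sum_distrib_left)
    have sets_T: "sets ?T = sets ?P"
      by (simp add: T)
    define A where "A = {x \<in> space ?P. \<bar>S x\<bar> < real n * \<epsilon>}"
    have [measurable]: "A \<in> sets ?P"
      unfolding A_def by measurable
    define k where "k = exp (real n * (c + \<epsilon>))"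
    interpret T: prob_space ?T
      by (intro prob_space_PiM prob_space_tilted)
    show ?case
    proof
      fix C assume [measurable]: "C \<in> sets ?P"
      \<comment> \<open>The two logarithmic densities are \<open>n * c + zmin * S\<close> relative
        to \<open>P\<close> and \<open>n * c - (1 - zmin) * S\<close> relative to \<open>Q\<close>.
        As \<open>zmin\<close> lies in (0, 1), each differs from \<open>n * c\<close> by at most the
        absolute value of \<open>S\<close>.\<close>
      have bound: "zmin * S x + real n * c \<le> real n * (c + \<epsilon>)"
          "zmin * S x + real n * c \<le> real n * (c + \<epsilon>) + S x" if "x \<in> A" for x
      proof -
        have "zmin * S x \<le> zmin * \<bar>S x\<bar>" "(1 - zmin) * (- S x) \<le> (1 - zmin) * \<bar>S x\<bar>"
          using zmin by (intro mult_left_mono; auto)+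
        moreover have "zmin * \<bar>S x\<bar> \<le> \<bar>S x\<bar>" "(1 - zmin) * \<bar>S x\<bar> \<le> \<bar>S x\<bar>"
          using zmin by (auto intro!: mult_left_le_one_le)
        ultimately show "zmin * S x + real n * c \<le> real n * (c + \<epsilon>)"
          "zmin * S x + real n * c \<le> real n * (c + \<epsilon>) + S x"
          using that by (auto simp: A_def algebra_simps)
      qed
      have 1: "emeasure ?T (A \<inter> C) \<le> ennreal k * emeasure ?P C"
      proof -
        have "emeasure ?T (A \<inter> C) = (\<integral>\<^sup>+x. ennreal (exp (zmin * S x + real n * c)) * indicator (A \<inter> C) x \<partial>?P)"
          unfolding T by (intro emeasure_density) auto
        also have "\<dots> \<le> (\<integral>\<^sup>+x. ennreal k * indicator C x \<partial>?P)"
          unfolding k_def by (intro nn_integral_mono) (auto split: split_indicator intro!: ennreal_leI bound)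
        finally show ?thesis by (simp add: nn_integral_cmult)
      qed
      have 2: "emeasure ?T (A - C) \<le> ennreal k * emeasure ?Q (space ?P - C)"
      proof -
        have "emeasure ?T (A - C) = (\<integral>\<^sup>+x. ennreal (exp (zmin * S x + real n * c)) * indicator (A - C) x \<partial>?P)"
          unfolding T by (intro emeasure_density) auto
        also have "\<dots> \<le> (\<integral>\<^sup>+x. ennreal k * (ennreal (exp (S x)) * indicator (space ?P - C) x) \<partial>?P)"
          unfolding k_def
          by (intro nn_integral_mono)
            (auto split: split_indicator intro!: ennreal_leI bound simp flip: ennreal_mult' exp_add)
        also have "\<dots> = ennreal k * emeasure ?Q (space ?P - C)"
          unfolding Q by (subst nn_integral_cmult) (auto simp: emeasure_density)
        finally show ?thesis .
      qed
      have 3: "emeasure ?T (space ?P - A) \<le> ennreal (1/2)"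
      proof -
        have "space ?P - A = {x \<in> space ?P. real n * \<epsilon> \<le> \<bar>\<Sum>i<n. l (x i)\<bar>}"
          by (auto simp: A_def S_def)
        then have "emeasure ?T (space ?P - A) \<le> ennreal (2 * exp (- r * real n))"
          using conc[of n] by simp
        also have "\<dots> \<le> ennreal (1/2)"
          using elim by (intro ennreal_leI) auto
        finally show ?thesis .
      qed
      have "1 = emeasure ?T (space ?P)"
        using T.emeasure_space_1 by (simp add: T)
      also have "space ?P = (A \<inter> C) \<union> (A - C) \<union> (space ?P - A)"
        by (auto simp: A_def)
      also have "emeasure ?T \<dots> \<le> emeasure ?T ((A \<inter> C) \<union> (A - C)) + emeasure ?T (space ?P - A)"
        by (intro emeasure_subadditive) (auto simp: sets_T)
      also have "\<dots> \<le> emeasure ?T (A \<inter> C) + emeasure ?T (A - C) + emeasure ?T (space ?P - A)"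
        by (intro add_right_mono emeasure_subadditive) (auto simp: sets_T)
      also have "\<dots> \<le> ennreal k * emeasure ?P C + ennreal k * emeasure ?Q (space ?P - C) + ennreal (1/2)"
        by (intro add_mono 1 2 3)
      also have "\<dots> = ennreal k * (emeasure ?P C + emeasure ?Q (space ?P - C)) + ennreal (1/2)"
        by (simp add: distrib_left)
      finally have *: "1 \<le> ennreal k * (emeasure ?P C + emeasure ?Q (space ?P - C)) + ennreal (1/2)" .
      have "ennreal (exp (- (real n * (c + \<epsilon>))) / 2) \<le> X" if "1 \<le> ennreal k * X + ennreal (1/2)" for X
      proof (cases X)
        case (real y)
        have "ennreal (k * y + 1/2) = ennreal k * X + ennreal (1/2)"
          using real by (subst ennreal_plus) (auto simp: k_def ennreal_mult)
        then have "1 \<le> k * y + 1/2"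
          using that one_le_ennreal_imp_le by metis
        then have "exp (- (real n * (c + \<epsilon>))) / 2 \<le> y"
          unfolding k_def exp_minus by (simp add: field_simps)
        then show ?thesis using real by (simp add: ennreal_leI)
      qed simp
      with * show "ennreal (exp (- (real n * (c + \<epsilon>))) / 2) \<le> emeasure ?P C + emeasure ?Q (space ?P - C)"
        by blast
    qed
  qed
qed

end

section \<open>Sets with \<open>C\<^sup>1\<close> boundary\<close>

text \<open>Derivatives within \<open>T\<close> cover boundary points. Asking for the existence of a
  gradient, rather than naming one, makes the notion pass to \<open>- f\<close> and to segments
  without any appeal to uniqueness.\<close>

definition gradient_bounded :: "('a::euclidean_space \<Rightarrow> real) \<Rightarrow> 'a set \<Rightarrow> real \<Rightarrow> bool" where
  "gradient_bounded f T B \<longleftrightarrow>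
     (\<forall>s\<in>T. \<exists>D. (f has_derivative (\<lambda>v. D \<bullet> v)) (at s within T) \<and> norm D \<le> B)"

lemma gradient_bounded_nonneg: "gradient_bounded f T B \<Longrightarrow> s \<in> T \<Longrightarrow> 0 \<le> B"
  unfolding gradient_bounded_def by (meson norm_ge_zero order.trans)

text \<open>The derivative is the inner product with the vector of its values on the basis, so the
  choice in \<open>gradient_within\<close> does select a gradient.\<close>

lemma gradient_boundedI:
  assumes "\<And>s. s \<in> T \<Longrightarrow> f differentiable (at s within T)"
    and "\<And>s. s \<in> T \<Longrightarrow> norm (gradient_within f T s) \<le> B"
  shows "gradient_bounded f T B"
  unfolding gradient_bounded_def
proof
  fix s assume s: "s \<in> T"
  obtain f' where f': "(f has_derivative f') (at s within T)"
    using assms(1)[OF s] by (auto simp: differentiable_def)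
  interpret f': linear f' using f' by (rule has_derivative_linear)
  have "f' v = (\<Sum>b\<in>Basis. f' b *\<^sub>R b) \<bullet> v" for v
  proof -
    have "f' v = f' (\<Sum>b\<in>Basis. (v \<bullet> b) *\<^sub>R b)"
      by (simp add: euclidean_representation)
    also have "\<dots> = (\<Sum>b\<in>Basis. f' b *\<^sub>R b) \<bullet> v"
      by (simp add: f'.sum f'.scaleR inner_sum_left mult.commute inner_commute[of v])
    finally show ?thesis .
  qed
  then have "f' = (\<lambda>v. (\<Sum>b\<in>Basis. f' b *\<^sub>R b) \<bullet> v)" by blast
  with f' have "\<exists>D. (f has_derivative (\<lambda>v. D \<bullet> v)) (at s within T)" by metis
  then have "(f has_derivative (\<lambda>v. gradient_within f T s \<bullet> v)) (at s within T)"
    unfolding gradient_within_def by (rule someI_ex)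
  with assms(2)[OF s] show "\<exists>D. (f has_derivative (\<lambda>v. D \<bullet> v)) (at s within T) \<and> norm D \<le> B"
    by blast
qed

lemma gradient_bounded_uminus:
  assumes "gradient_bounded f T B" shows "gradient_bounded (\<lambda>t. - f t) T B"
  unfolding gradient_bounded_def
proof
  fix s assume "s \<in> T"
  then obtain D where D: "(f has_derivative (\<lambda>v. D \<bullet> v)) (at s within T)" "norm D \<le> B"
    using assms by (auto simp: gradient_bounded_def)
  then have "((\<lambda>t. - f t) has_derivative (\<lambda>v. (- D) \<bullet> v)) (at s within T)"
    by (auto intro!: derivative_eq_intros)
  with D show "\<exists>D. ((\<lambda>t. - f t) has_derivative (\<lambda>v. D \<bullet> v)) (at s within T) \<and> norm D \<le> B"
    by (metis norm_minus_cancel)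
qed

text \<open>The mean value inequality on the segment alone: \<open>T\<close> need not be convex, and
  a derivative within \<open>T\<close> restricts to a derivative within the segment.\<close>

lemma gradient_bounded_segment:
  assumes f: "gradient_bounded f T B" and seg: "closed_segment x y \<subseteq> T"
  shows "\<bar>f x - f y\<bar> \<le> B * dist x y"
proof -
  obtain D where D: "\<And>s. s \<in> T \<Longrightarrow> (f has_derivative (\<lambda>v. D s \<bullet> v)) (at s within T)"
      "\<And>s. s \<in> T \<Longrightarrow> norm (D s) \<le> B"
    using f unfolding gradient_bounded_def by metis
  have "norm (f x - f y) \<le> B * norm (x - y)"
  proof (rule differentiable_bound[where S="closed_segment x y" and f'="\<lambda>s v. D s \<bullet> v"])
    fix s assume s: "s \<in> closed_segment x y"
    show "(f has_derivative (\<bullet>) (D s)) (at s within closed_segment x y)"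
      using D(1)[of s] s seg by (auto intro: has_derivative_subset)
    have "onorm ((\<bullet>) (D s)) \<le> norm (D s)"
      by (rule onorm_bound) (auto simp: Cauchy_Schwarz_ineq2)
    also have "\<dots> \<le> B" using D(2) s seg by auto
    finally show "onorm ((\<bullet>) (D s)) \<le> B" .
  qed auto
  then show ?thesis by (simp add: dist_norm)
qed

lemma gradient_mvt:
  fixes \<phi> :: "'a::euclidean_space \<Rightarrow> real"
  assumes "\<And>x. x \<in> closed_segment a b \<Longrightarrow> (\<phi> has_derivative (\<lambda>v. G x \<bullet> v)) (at x)"
  shows "\<exists>\<xi>\<in>closed_segment a b. \<phi> b - \<phi> a = G \<xi> \<bullet> (b - a)"
proof -
  define p where "p t = a + t *\<^sub>R (b - a)" for t :: real
  have p: "p t \<in> closed_segment a b" if "0 \<le> t" "t \<le> 1" for t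
    using that by (auto simp: p_def in_segment algebra_simps intro!: exI[of _ t])
  have "\<exists>z. 0 < z \<and> z < 1 \<and> \<phi> (p 1) - \<phi> (p 0) = (1 - 0) * (G (p z) \<bullet> (b - a))"
  proof (rule MVT2)
    fix t :: real assume t: "0 \<le> t" "t \<le> 1"
    have "(p has_derivative (\<lambda>h. h *\<^sub>R (b - a))) (at t)"
      unfolding p_def by (auto intro!: derivative_eq_intros)
    from has_derivative_compose[OF this assms[OF p[OF t]]]
    show "((\<lambda>t. \<phi> (p t)) has_real_derivative G (p t) \<bullet> (b - a)) (at t)"
      by (simp only: has_field_derivative_def inner_scaleR_right mult.commute[of _ "G (p t) \<bullet> (b - a)"])
  qed simp
  then show ?thesis
    using p by (force simp: p_def)
qed

text \<open>Near a boundary point, two points of the set are joined by moving inwards, across, and back: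
  a polygon inside the set of length at most 9 times their distance.\<close>

lemma C1_boundary_locally_Lipschitz:
  fixes T :: "'a::euclidean_space set"
  assumes "C1_boundary T" and p: "p \<in> T"
  obtains r where "0 < r"
    "\<And>x y f B. x \<in> T \<inter> ball p r \<Longrightarrow> y \<in> T \<inter> ball p r \<Longrightarrow> gradient_bounded f T B \<Longrightarrow>
      \<bar>f x - f y\<bar> \<le> 9 * B * dist x y"
proof (cases "p \<in> interior T")
  case True
  then obtain r where r: "0 < r" "ball p r \<subseteq> T"
    by (meson mem_interior)
  show ?thesis
  proof (rule that[OF r(1)])
    fix x y f B
    assume x: "x \<in> T \<inter> ball p r" and y: "y \<in> T \<inter> ball p r" and f: "gradient_bounded f T B"
    have "closed_segment x y \<subseteq> ball p r"
      using x y by (intro closed_segment_subset convex_ball) auto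
    then have "\<bar>f x - f y\<bar> \<le> B * dist x y"
      using r by (intro gradient_bounded_segment[OF f]) auto
    also have "\<dots> \<le> 9 * B * dist x y"
      using gradient_bounded_nonneg[OF f p] by (intro mult_right_mono) auto
    finally show "\<bar>f x - f y\<bar> \<le> 9 * B * dist x y" .
  qed
next
  case False
  then have p_frontier: "p \<in> frontier T"
    using p closure_subset by (auto simp: frontier_def)
  obtain U \<phi> \<phi>' where U: "open U" "p \<in> U"
    and \<phi>: "\<And>x. x \<in> U \<Longrightarrow> (\<phi> has_derivative (\<lambda>v. \<phi>' x \<bullet> v)) (at x)" "\<And>x. x \<in> U \<Longrightarrow> \<phi>' x \<noteq> 0"
    and cont: "continuous_on U \<phi>'" and TU: "T \<inter> U = {x \<in> U. \<phi> x \<le> (0::real)}"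
    using bspec[OF assms(1)[unfolded C1_boundary_def] p_frontier] by (elim exE conjE) (rule that, auto)
  define \<nu> where "\<nu> = \<phi>' p"
  have \<nu>: "0 < norm \<nu>" using \<phi>(2) U by (simp add: \<nu>_def)
  \<comment> \<open>On a small ball the gradient stays within half of \<open>norm \<nu>\<close> of
    \<nu>. Hence \<phi> falls at rate at least \<open>norm \<nu> / 2\<close> along the inward unit
    normal \<open>u\<close> and rises at rate at most \<open>3/2 * norm \<nu>\<close> in any
    direction.\<close>
  have "isCont \<phi>' p"
    using cont U by (simp add: continuous_on_eq_continuous_at)
  then obtain r1 where r1: "0 < r1" "\<And>x. dist x p < r1 \<Longrightarrow> dist (\<phi>' x) \<nu> < norm \<nu> / 2"
    using \<nu> unfolding continuous_at_eps_delta \<nu>_def by (meson half_gt_zero)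
  obtain r2 where r2: "0 < r2" "ball p r2 \<subseteq> U"
    using U by (meson open_contains_ball)
  define r0 where "r0 = min r1 r2"
  have r0: "0 < r0" "ball p r0 \<subseteq> U"
    using r1(1) r2 by (auto simp: r0_def)
  have r0_norm: "norm (\<phi>' x - \<nu>) \<le> norm \<nu> / 2" if "x \<in> ball p r0" for x
  proof -
    have "dist x p < r1" using that by (simp add: r0_def dist_commute)
    from r1(2)[OF this] show ?thesis unfolding dist_norm by simp
  qed
  define u where "u = - (1 / norm \<nu>) *\<^sub>R \<nu>"
  have u: "norm u = 1" "\<nu> \<bullet> u = - norm \<nu>"
    using \<nu> by (simp_all add: u_def dot_square_norm power2_eq_square)
  have mvt: "\<exists>\<xi>\<in>ball p r0. \<phi> b - \<phi> a = \<phi>' \<xi> \<bullet> (b - a)" if "a \<in> ball p r0" "b \<in> ball p r0" for a b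
  proof -
    have "closed_segment a b \<subseteq> ball p r0"
      using that by (intro closed_segment_subset convex_ball)
    then show ?thesis
      using gradient_mvt[of a b \<phi> \<phi>'] r0(2) \<phi>(1) by blast
  qed
  have inward: "\<phi> (x + \<tau> *\<^sub>R u) \<le> \<phi> x - \<tau> * norm \<nu> / 2"
    if x: "x \<in> ball p r0" "x + \<tau> *\<^sub>R u \<in> ball p r0" and \<tau>: "0 \<le> \<tau>" for x \<tau>
  proof -
    obtain \<xi> where \<xi>: "\<xi> \<in> ball p r0" "\<phi> (x + \<tau> *\<^sub>R u) - \<phi> x = \<phi>' \<xi> \<bullet> (\<tau> *\<^sub>R u)"
      using mvt[OF x] by auto
    have "\<phi>' \<xi> \<bullet> u = \<nu> \<bullet> u + (\<phi>' \<xi> - \<nu>) \<bullet> u"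
      by (simp add: inner_diff_left)
    also have "(\<phi>' \<xi> - \<nu>) \<bullet> u \<le> norm (\<phi>' \<xi> - \<nu>) * norm u"
      by (rule norm_cauchy_schwarz)
    also have "\<dots> \<le> norm \<nu> / 2"
      using r0_norm[OF \<xi>(1)] u by simp
    finally have "\<phi>' \<xi> \<bullet> u \<le> - norm \<nu> / 2"
      using u by simp
    then have "\<tau> * (\<phi>' \<xi> \<bullet> u) \<le> \<tau> * (- norm \<nu> / 2)"
      using \<tau> by (intro mult_left_mono)
    with \<xi>(2) show ?thesis by simp
  qed
  have across: "\<phi> b \<le> \<phi> a + 3/2 * norm \<nu> * norm (b - a)"
    if ab: "a \<in> ball p r0" "b \<in> ball p r0" for a b
  proof -
    obtain \<xi> where \<xi>: "\<xi> \<in> ball p r0" "\<phi> b - \<phi> a = \<phi>' \<xi> \<bullet> (b - a)"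
      using mvt[OF ab] by auto
    have "norm (\<phi>' \<xi>) \<le> norm \<nu> + norm (\<phi>' \<xi> - \<nu>)"
      by (rule norm_triangle_sub)
    also have "\<dots> \<le> 3/2 * norm \<nu>"
      using r0_norm[OF \<xi>(1)] by simp
    finally have "norm (\<phi>' \<xi>) * norm (b - a) \<le> 3/2 * norm \<nu> * norm (b - a)"
      by (rule mult_right_mono) simp
    then show ?thesis
      using \<xi>(2) norm_cauchy_schwarz[of "\<phi>' \<xi>" "b - a"] by linarith
  qed
  \<comment> \<open>The points of the polygon start within distance \<open>3 * r\<close> of
    \<open>p\<close> and move inwards by less than \<open>8 * r\<close>, which stays inside the ball
    of radius \<open>r0\<close>.\<close>
  define r where "r = r0 / 16"
  have "0 < r" using r0 by (simp add: r_def)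
  have inT: "x \<in> T" if "x \<in> ball p r0" "\<phi> x \<le> 0" for x
    using that TU r0(2) by blast
  have T_le: "\<phi> x \<le> 0" if "x \<in> T" "x \<in> ball p r0" for x
    using that TU r0(2) by blast
  show ?thesis
  proof (rule that[OF \<open>0 < r\<close>])
    fix x y f B
    assume x: "x \<in> T \<inter> ball p r" and y: "y \<in> T \<inter> ball p r" and f: "gradient_bounded f T B"
    define d where "d = dist x y"
    \<comment> \<open>Moving inwards by \<open>4 * d\<close> lowers \<phi> by at least
      \<open>2 * norm \<nu> * d\<close>, more than the \<open>3/2 * norm \<nu> * d\<close> that
      crossing can cost. The two inward legs and the crossing have total length
      \<open>4 * d + d + 4 * d\<close>, the factor 9.\<close>
    define s where "s = 4 * d"
    have d: "0 \<le> d" "d < 2 * r"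
      using x y dist_triangle_less_add[of x p r y r] by (auto simp: d_def dist_commute)
    then have s: "0 \<le> s" "s < 8 * r" by (auto simp: s_def)
    have in_ball: "z + \<tau> *\<^sub>R u \<in> ball p r0" if "dist p z < 3 * r" "0 \<le> \<tau>" "\<tau> \<le> s" for z \<tau>
    proof -
      have "dist p (z + \<tau> *\<^sub>R u) \<le> dist p z + dist z (z + \<tau> *\<^sub>R u)"
        by (rule dist_triangle)
      also have "\<dots> < 3 * r + 8 * r"
        using that s u by (intro add_less_le_mono) (auto simp: dist_norm)
      also have "\<dots> \<le> r0" using r0 by (simp add: r_def)
      finally show ?thesis by simp
    qed
    have xy_ball: "z \<in> ball p r0" if "z \<in> ball p r" for z
      using that r0(1) by (auto simp: r_def)
    have seg_in: "closed_segment z (z + s *\<^sub>R u) \<subseteq> T" if z: "z \<in> T \<inter> ball p r" for z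
    proof
      fix w assume "w \<in> closed_segment z (z + s *\<^sub>R u)"
      then obtain q where q: "0 \<le> q" "q \<le> 1" "w = (1 - q) *\<^sub>R z + q *\<^sub>R (z + s *\<^sub>R u)"
        by (auto simp: in_segment)
      then have w: "w = z + (q * s) *\<^sub>R u"
        by (simp add: algebra_simps)
      have qs: "0 \<le> q * s" "q * s \<le> s"
        using q s by (auto intro: mult_left_le_one_le)
      have ball: "w \<in> ball p r0"
        unfolding w using z qs \<open>0 < r\<close> by (intro in_ball) auto
      moreover have "\<phi> w \<le> \<phi> z - (q * s) * norm \<nu> / 2"
        unfolding w by (rule inward[OF xy_ball ball[unfolded w] qs(1)]) (use z in auto)
      then have "\<phi> w \<le> 0"
        using T_le[of z] z xy_ball mult_nonneg_nonneg[OF qs(1) norm_ge_zero[of \<nu>]] by auto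
      ultimately show "w \<in> T" by (rule inT)
    qed
    have mid: "closed_segment (x + s *\<^sub>R u) (y + s *\<^sub>R u) \<subseteq> T"
    proof
      fix w assume "w \<in> closed_segment (x + s *\<^sub>R u) (y + s *\<^sub>R u)"
      then obtain q where q: "0 \<le> q" "q \<le> 1"
        "w = (1 - q) *\<^sub>R (x + s *\<^sub>R u) + q *\<^sub>R (y + s *\<^sub>R u)"
        by (auto simp: in_segment)
      define v where "v = x + q *\<^sub>R (y - x)"
      have w: "w = v + s *\<^sub>R u"
        using q(3) by (simp add: v_def algebra_simps)
      have qd: "q * d \<le> d"
        using q d by (auto intro: mult_left_le_one_le)
      have "dist p v \<le> dist p x + dist x v"
        by (rule dist_triangle)
      also have "dist x v = q * d"
        using q by (simp add: v_def d_def dist_norm norm_minus_commute)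
      also have "dist p x + q * d < 3 * r"
        using x qd d by auto
      finally have ball: "w \<in> ball p r0"
        unfolding w using s by (intro in_ball) auto
      have xs: "x + s *\<^sub>R u \<in> ball p r0"
        using x s \<open>0 < r\<close> by (intro in_ball) auto
      have "w - (x + s *\<^sub>R u) = q *\<^sub>R (y - x)"
        by (simp add: w v_def)
      then have "norm (w - (x + s *\<^sub>R u)) = q * d"
        using q by (simp only: norm_scaleR) (simp add: d_def dist_norm norm_minus_commute)
      then have "\<phi> w \<le> \<phi> (x + s *\<^sub>R u) + 3/2 * norm \<nu> * (q * d)"
        using across[OF xs ball] by simp
      also have "\<dots> \<le> \<phi> x - s * norm \<nu> / 2 + 3/2 * norm \<nu> * d"
        using inward[of x s] x xs s xy_ball qd by (intro add_mono mult_left_mono) auto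
      also have "\<dots> = \<phi> x - norm \<nu> * d / 2"
        by (simp add: s_def algebra_simps)
      also have "\<dots> \<le> 0"
        using T_le[of x] x xy_ball mult_nonneg_nonneg[OF norm_ge_zero[of \<nu>] d(1)] by auto
      finally show "w \<in> T" by (rule inT[OF ball])
    qed
    have us: "dist z (z + s *\<^sub>R u) = s" for z
      using s u by (simp add: dist_norm)
    have "\<bar>f x - f (x + s *\<^sub>R u)\<bar> \<le> B * s" "\<bar>f y - f (y + s *\<^sub>R u)\<bar> \<le> B * s"
      using gradient_bounded_segment[OF f seg_in[OF x]] gradient_bounded_segment[OF f seg_in[OF y]]
      by (auto simp: us)
    moreover have "\<bar>f (x + s *\<^sub>R u) - f (y + s *\<^sub>R u)\<bar> \<le> B * d"
      using gradient_bounded_segment[OF f mid] by (simp add: d_def)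
    ultimately have "\<bar>f x - f y\<bar> \<le> B * s + B * d + B * s" by linarith
    also have "\<dots> = 9 * B * dist x y"
      by (simp add: s_def d_def)
    finally show "\<bar>f x - f y\<bar> \<le> 9 * B * dist x y" .
  qed
qed

text \<open>Cut space into grid cells and take one point of \<open>S\<close> from every cell that
  meets \<open>S\<close>. A coordinate ranges over at most \<open>2 * R / e + 2\<close> cells, and
  as \<delta> is at most 1 this is at most \<open>(2 * R * d + 2) / \<delta>\<close>.\<close>

lemma bounded_finite_net:
  fixes S :: "'a::euclidean_space set"
  assumes "bounded S"
  obtains A where "0 \<le> A"
    "\<And>\<delta>. 0 < \<delta> \<Longrightarrow> \<delta> \<le> 1 \<Longrightarrow> \<exists>N. finite N \<and> N \<subseteq> S \<and> real (card N) \<le> A / \<delta> ^ DIM('a) \<and>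
       (\<forall>x\<in>S. \<exists>y\<in>N. dist x y \<le> \<delta>)"
proof -
  obtain R where R: "0 < R" "\<And>x. x \<in> S \<Longrightarrow> norm x \<le> R"
    using assms by (meson bounded_pos)
  define d where "d = real DIM('a)"
  have d: "1 \<le> d" by (simp add: d_def DIM_ge_Suc0 Suc_leI)
  show ?thesis
  proof (rule that[of "(2 * R * d + 2) ^ DIM('a)"])
    fix \<delta> :: real assume \<delta>: "0 < \<delta>" "\<delta> \<le> 1"
    \<comment> \<open>Points of one cell differ by at most \<open>e\<close> in each coordinate, and
      the norm is at most the sum of the coordinate differences, that is
      \<open>d * e = \<delta>\<close>.\<close>
    define e where "e = \<delta> / d"
    have e: "0 < e" using \<delta> d by (simp add: e_def)
    define cell where "cell x = (\<lambda>b\<in>Basis. \<lfloor>(x \<bullet> b) / e\<rfloor>)" for x :: 'a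
    define G where "G = {\<lfloor>- R / e\<rfloor>..\<lfloor>R / e\<rfloor>}"
    have "cell ` S \<subseteq> (Basis :: 'a set) \<rightarrow>\<^sub>E G"
    proof (safe intro!: PiE_I)
      fix x and b :: 'a assume x: "x \<in> S" and b: "b \<in> Basis"
      then have "\<bar>x \<bullet> b\<bar> \<le> R"
        using R(2)[OF x] Basis_le_norm[OF b, of x] by linarith
      then have "- R \<le> x \<bullet> b" "x \<bullet> b \<le> R" by auto
      then have "\<lfloor>- R / e\<rfloor> \<le> \<lfloor>x \<bullet> b / e\<rfloor>" "\<lfloor>x \<bullet> b / e\<rfloor> \<le> \<lfloor>R / e\<rfloor>"
        using e by (simp_all only: floor_mono divide_right_mono less_imp_le)
      then show "cell x b \<in> G"
        using b by (simp add: cell_def G_def)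
    qed (auto simp: cell_def)
    moreover have fin_G: "finite ((Basis :: 'a set) \<rightarrow>\<^sub>E G)"
      by (intro finite_PiE) (auto simp: G_def)
    ultimately have fin: "finite (cell ` S)" "card (cell ` S) \<le> card ((Basis :: 'a set) \<rightarrow>\<^sub>E G)"
      by (auto intro: finite_subset card_mono)
    have "real (card G) \<le> (2 * R * d + 2) / \<delta>"
    proof -
      have "\<lfloor>- R / e\<rfloor> \<le> \<lfloor>R / e\<rfloor>"
        using R e by (intro floor_mono divide_right_mono) auto
      then have "real (card G) = real_of_int (\<lfloor>R / e\<rfloor> + 1 - \<lfloor>- R / e\<rfloor>)"
        by (simp add: G_def)
      also have "\<dots> \<le> R / e + 1 - (- R / e - 1)"
        by linarith
      also have "\<dots> = 2 * R * d / \<delta> + 2"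
        using d \<delta> by (simp add: e_def)
      also have "\<dots> \<le> 2 * R * d / \<delta> + 2 / \<delta>"
        using \<delta> by (simp add: field_simps)
      finally show ?thesis by (simp add: add_divide_distrib)
    qed
    then have "real (card G) ^ DIM('a) \<le> ((2 * R * d + 2) / \<delta>) ^ DIM('a)"
      by (intro power_mono) auto
    then have card: "real (card (cell ` S)) \<le> (2 * R * d + 2) ^ DIM('a) / \<delta> ^ DIM('a)"
      using fin(2) unfolding card_PiE[OF finite_Basis] prod_constant power_divide
      by (metis (mono_tags) of_nat_le_iff of_nat_power order.trans)
    \<comment> \<open>Representatives are taken from \<open>S\<close> itself instead of the grid,
      because the densities are under control only at parameters in the set.\<close>
    define N where "N = inv_into S cell ` (cell ` S)"
    have "finite N" using fin by (simp add: N_def)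
    moreover have "N \<subseteq> S" by (auto simp: N_def inv_into_into)
    moreover have "real (card N) \<le> (2 * R * d + 2) ^ DIM('a) / \<delta> ^ DIM('a)"
      using card_image_le[OF fin(1), of "inv_into S cell"] card unfolding N_def by linarith
    moreover have "\<exists>y\<in>N. dist x y \<le> \<delta>" if x: "x \<in> S" for x
    proof -
      define y where "y = inv_into S cell (cell x)"
      have cell_y: "cell y = cell x"
        using x by (simp add: y_def f_inv_into_f)
      have "\<bar>(x - y) \<bullet> b\<bar> \<le> e" if b: "b \<in> Basis" for b
      proof -
        have "\<lfloor>x \<bullet> b / e\<rfloor> = \<lfloor>y \<bullet> b / e\<rfloor>"
          using fun_cong[OF cell_y, of b] b by (simp add: cell_def)
        then have "\<bar>x \<bullet> b / e - y \<bullet> b / e\<bar> \<le> 1"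
          by linarith
        then show ?thesis
          using e by (simp add: inner_diff_left field_simps flip: diff_divide_distrib)
      qed
      then have "norm (x - y) \<le> (\<Sum>b\<in>(Basis::'a set). e)"
        by (intro order.trans[OF norm_le_l1] sum_mono)
      also have "\<dots> = \<delta>"
        using d by (simp add: e_def d_def)
      finally show ?thesis
        using x by (intro bexI[of _ y]) (auto simp: dist_norm N_def y_def)
    qed
    ultimately show "\<exists>N. finite N \<and> N \<subseteq> S \<and> real (card N) \<le> (2 * R * d + 2) ^ DIM('a) / \<delta> ^ DIM('a) \<and>
       (\<forall>x\<in>S. \<exists>y\<in>N. dist x y \<le> \<delta>)"
      by blast
  qed (use R d in auto)
qed

text \<open>The Lipschitz estimate is only local, so a finite cover by good balls is chosen first
  and each piece of \<open>T\<close> receives its own net; a point and its representative then lie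
  in the same ball. The representative does not depend on \<open>f\<close> and \<open>B\<close>, so
  it serves the log-likelihood ratios of all observations simultaneously.\<close>

lemma compact_C1_boundary_net:
  fixes T :: "'a::euclidean_space set"
  assumes T: "compact T" and C1: "C1_boundary T"
  obtains A where "0 \<le> A"
    "\<And>\<delta>. 0 < \<delta> \<Longrightarrow> \<delta> \<le> 1 \<Longrightarrow> \<exists>N. finite N \<and> N \<subseteq> T \<and> real (card N) \<le> A / \<delta> ^ DIM('a) \<and>
       (\<forall>t\<in>T. \<exists>t'\<in>N. \<forall>f B. gradient_bounded f T B \<longrightarrow> \<bar>f t - f t'\<bar> \<le> 9 * B * \<delta>)"
proof -
  have "\<exists>r. 0 < r \<and> (\<forall>x \<in> T \<inter> ball p r. \<forall>y \<in> T \<inter> ball p r. \<forall>f B. gradient_bounded f T B \<longrightarrow>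
      \<bar>f x - f y\<bar> \<le> 9 * B * dist x y)" if "p \<in> T" for p
    using C1_boundary_locally_Lipschitz[OF C1 that] by metis
  then obtain r where r: "\<And>p. p \<in> T \<Longrightarrow> 0 < r p"
    "\<And>p x y f B. p \<in> T \<Longrightarrow> x \<in> T \<inter> ball p (r p) \<Longrightarrow> y \<in> T \<inter> ball p (r p) \<Longrightarrow>
       gradient_bounded f T B \<Longrightarrow> \<bar>f x - f y\<bar> \<le> 9 * B * dist x y"
    by metis
  obtain F where F: "finite F" "F \<subseteq> T" "T \<subseteq> (\<Union>p\<in>F. ball p (r p))"
  proof (rule compactE_image[OF T])
    show "open (ball p (r p))" for p by simp
    show "T \<subseteq> (\<Union>p\<in>T. ball p (r p))" using r(1) by force
  qed
  have "\<exists>A. 0 \<le> A \<and> (\<forall>\<delta>. 0 < \<delta> \<longrightarrow> \<delta> \<le> 1 \<longrightarrow> (\<exists>N. finite N \<and> N \<subseteq> T \<inter> ball p (r p) \<and>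
      real (card N) \<le> A / \<delta> ^ DIM('a) \<and> (\<forall>x \<in> T \<inter> ball p (r p). \<exists>y\<in>N. dist x y \<le> \<delta>)))" for p
  proof -
    have "bounded (T \<inter> ball p (r p))" by auto
    from bounded_finite_net[OF this] show ?thesis by metis
  qed
  then obtain A where A: "\<And>p. 0 \<le> A p" "\<And>p \<delta>. 0 < \<delta> \<Longrightarrow> \<delta> \<le> 1 \<Longrightarrow> \<exists>N. finite N \<and> N \<subseteq> T \<inter> ball p (r p) \<and>
      real (card N) \<le> A p / \<delta> ^ DIM('a) \<and> (\<forall>x \<in> T \<inter> ball p (r p). \<exists>y\<in>N. dist x y \<le> \<delta>)"
    by metis
  show ?thesis
  proof (rule that[of "\<Sum>p\<in>F. A p"])
    fix \<delta> :: real assume \<delta>: "0 < \<delta>" "\<delta> \<le> 1"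
    obtain N where N: "\<And>p. finite (N p)" "\<And>p. N p \<subseteq> T \<inter> ball p (r p)"
      "\<And>p. real (card (N p)) \<le> A p / \<delta> ^ DIM('a)"
      "\<And>p x. x \<in> T \<inter> ball p (r p) \<Longrightarrow> \<exists>y\<in>N p. dist x y \<le> \<delta>"
      using A(2)[OF \<delta>] by metis
    have "real (card (\<Union>p\<in>F. N p)) \<le> (\<Sum>p\<in>F. real (card (N p)))"
      using card_UN_le[OF F(1), of N] by (metis of_nat_le_iff of_nat_sum)
    also have "\<dots> \<le> (\<Sum>p\<in>F. A p) / \<delta> ^ DIM('a)"
      unfolding sum_divide_distrib by (intro sum_mono N)
    finally have card: "real (card (\<Union>p\<in>F. N p)) \<le> (\<Sum>p\<in>F. A p) / \<delta> ^ DIM('a)" .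
    have "\<exists>t'\<in>(\<Union>p\<in>F. N p). \<forall>f B. gradient_bounded f T B \<longrightarrow> \<bar>f t - f t'\<bar> \<le> 9 * B * \<delta>" if t: "t \<in> T" for t
    proof -
      obtain p where p: "p \<in> F" "t \<in> T \<inter> ball p (r p)"
        using F(3) t by auto
      obtain t' where t': "t' \<in> N p" "dist t t' \<le> \<delta>"
        using N(4)[OF p(2)] by auto
      have "\<bar>f t - f t'\<bar> \<le> 9 * B * \<delta>" if f: "gradient_bounded f T B" for f B
      proof -
        have "\<bar>f t - f t'\<bar> \<le> 9 * B * dist t t'"
          using p F(2) N(2)[of p] t'(1) by (intro r(2)[of p] f) auto
        also have "\<dots> \<le> 9 * B * \<delta>"
          using gradient_bounded_nonneg[OF f t] t'(2) by (intro mult_left_mono) auto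
        finally show ?thesis .
      qed
      then show ?thesis using p(1) t'(1) by blast
    qed
    then show "\<exists>N. finite N \<and> N \<subseteq> T \<and> real (card N) \<le> (\<Sum>p\<in>F. A p) / \<delta> ^ DIM('a) \<and>
       (\<forall>t\<in>T. \<exists>t'\<in>N. \<forall>f B. gradient_bounded f T B \<longrightarrow> \<bar>f t - f t'\<bar> \<le> 9 * B * \<delta>)"
      using N(1,2) F(1) card by (intro exI[of _ "\<Union>p\<in>F. N p"]) blast
  qed (use A in \<open>auto intro: sum_nonneg\<close>)
qed

section \<open>The union bound over a net\<close>

text \<open>The first summand is Chernoff's bound summed over the net, the second the probability
  that one of n scores exceeds \<open>B\<close>. Each is made at most half of the right-hand
  side.\<close>

lemma net_parameters_eventually:
  fixes A \<epsilon> \<eta> \<rho> x0 :: real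
  assumes A: "0 \<le> A" and \<epsilon>: "0 < \<epsilon>" and \<eta>: "0 < \<eta>"
  shows "\<forall>\<^sub>F n in sequentially. \<exists>B \<delta>. x0 < B \<and> 0 < B \<and> 0 < \<delta> \<and> \<delta> \<le> 1 \<and>
    A / \<delta> ^ d * exp (9 * real n * B * \<delta>) * exp (- (real n * \<rho>)) + real n * exp (- (ln B powr (1 + \<eta>)))
      \<le> exp (- (real n * (\<rho> - \<epsilon>)))"
proof -
  \<comment> \<open>The inverse of \<open>1 + \<eta> / 2\<close>, the midpoint between 1 and
    \<open>1 + \<eta>\<close>. So \<alpha> is below 1, which keeps the net subexponential, and
    \<beta> is above 1, which makes the score tail superexponential.\<close>
  define \<alpha> where "\<alpha> = 2 / (2 + \<eta>)"
  define \<beta> where "\<beta> = \<alpha> * (1 + \<eta>)"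
  have \<alpha>: "0 < \<alpha>" "\<alpha> < 1" and \<beta>: "1 < \<beta>"
    using \<eta> by (auto simp: \<alpha>_def \<beta>_def field_simps)
  define B where "B n = exp (real n powr \<alpha>)" for n :: nat
  \<comment> \<open>With mesh \<open>k / B n\<close> the approximation costs
    \<open>9 * n * k = n * \<epsilon> / 2\<close> in the exponent; the other half of \<epsilon> pays
    for the cardinality of the net.\<close>
  define k where "k = \<epsilon> / 18"
  have k: "0 < k" using \<epsilon> by (simp add: k_def)
  have "filterlim B at_top sequentially"
    unfolding B_def using \<alpha> by real_asymp
  then have 1: "\<forall>\<^sub>F n in sequentially. max (max x0 0) k < B n"
    unfolding filterlim_at_top_dense by blast
  have "((\<lambda>n. A / k ^ d * exp (real d * real n powr \<alpha> - real n * (\<epsilon> / 2))) \<longlongrightarrow> A / k ^ d * 0) sequentially"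
    using \<alpha> \<epsilon> by (intro tendsto_mult tendsto_const) real_asymp
  then have 2: "\<forall>\<^sub>F n in sequentially. A / k ^ d * exp (real d * real n powr \<alpha> - real n * (\<epsilon> / 2)) < 1/2"
    by (rule order_tendstoD) simp
  have "((\<lambda>n. real n * exp (real n * (\<rho> - \<epsilon>) - real n powr \<beta>)) \<longlongrightarrow> 0) sequentially"
    using \<beta> by real_asymp
  then have 3: "\<forall>\<^sub>F n in sequentially. real n * exp (real n * (\<rho> - \<epsilon>) - real n powr \<beta>) < 1/2"
    by (rule order_tendstoD) simp
  show ?thesis
    using 1 2 3
  proof eventually_elim
    case (elim n)
    have B: "x0 < B n" "0 < B n" "k < B n" using elim(1) by auto
    define e where "e = exp (- (real n * (\<rho> - \<epsilon>)))"
    have "A / (k / B n) ^ d * exp (9 * real n * B n * (k / B n)) * exp (- (real n * \<rho>)) =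
        A / k ^ d * exp (real d * real n powr \<alpha> - real n * (\<epsilon> / 2)) * e"
    proof -
      have 1: "exp (9 * real n * B n * (k / B n)) = exp (real n * (\<epsilon> / 2))"
        using B by (simp add: k_def)
      have 2: "B n ^ d = exp (real d * real n powr \<alpha>)"
        by (simp add: B_def exp_of_nat_mult)
      have 3: "exp (real d * real n powr \<alpha>) * exp (real n * (\<epsilon> / 2)) * exp (- (real n * \<rho>))
          = exp (real d * real n powr \<alpha> - real n * (\<epsilon> / 2)) * e"
        by (simp add: e_def algebra_simps flip: exp_add)
      have "a / (b / x) * y * z = a / b * (x * y * z)" for a b x y z :: real
        by simp
      then show ?thesis
        unfolding power_divide 1 2 by (simp only: 3[unfolded mult.assoc] mult.assoc)
    qed
    also have "\<dots> \<le> 1/2 * e"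
      using elim(2) by (intro mult_right_mono) (auto simp: e_def)
    finally have *: "A / (k / B n) ^ d * exp (9 * real n * B n * (k / B n)) * exp (- (real n * \<rho>)) \<le> 1/2 * e" .
    have "ln (B n) powr (1 + \<eta>) = real n powr \<beta>"
      by (simp add: B_def powr_powr \<beta>_def)
    then have "real n * exp (- (ln (B n) powr (1 + \<eta>))) = real n * exp (real n * (\<rho> - \<epsilon>) - real n powr \<beta>) * e"
      by (simp add: e_def flip: exp_add)
    also have "\<dots> \<le> 1/2 * e"
      using elim(3) by (intro mult_right_mono) (auto simp: e_def)
    finally have "A / (k / B n) ^ d * exp (9 * real n * B n * (k / B n)) * exp (- (real n * \<rho>)) +
        real n * exp (- (ln (B n) powr (1 + \<eta>))) \<le> 1/2 * e + 1/2 * e"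
      by (rule add_mono[OF *])
    then have "A / (k / B n) ^ d * exp (9 * real n * B n * (k / B n)) * exp (- (real n * \<rho>)) +
        real n * exp (- (ln (B n) powr (1 + \<eta>))) \<le> exp (- (real n * (\<rho> - \<epsilon>)))"
      unfolding e_def by linarith
    then show ?case
      using B k by (intro exI[of _ "B n"] exI[of _ "k / B n"]) auto
  qed
qed

text \<open>A union bound: outside the event that some score exceeds \<open>B\<close>, the log-likelihood ratio
  sums are within \<open>9 n B \<delta>\<close> of their values on the net.\<close>

lemma emeasure_exceedance_le:
  fixes T :: "'a::euclidean_space set" and u :: "'a \<Rightarrow> real \<Rightarrow> real" and S :: "real \<Rightarrow> ennreal"
  assumes N: "prob_space N" and sets_N: "sets N = sets borel"
    and u_meas: "\<And>t. t \<in> T \<Longrightarrow> u t \<in> borel_measurable borel"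
    and cramer: "\<And>t. t \<in> T \<Longrightarrow> \<exists>z. 0 < z \<and> z \<le> 1 \<and> (\<integral>\<^sup>+x. ennreal (exp (z * u t x)) \<partial>N) \<le> ennreal (exp (- \<rho>))"
    and G: "G \<in> sets borel" "emeasure N (- G) = 0"
    and S: "\<And>x B. x \<in> G \<Longrightarrow> 0 \<le> B \<Longrightarrow> S x \<le> ennreal B \<Longrightarrow> gradient_bounded (\<lambda>t. u t x) T B"
    and tail: "outer_measure_of N {x. S x > ennreal B} \<le> ennreal q" and q: "0 \<le> q" and B: "0 \<le> B"
    and net: "finite net" "net \<subseteq> T" "real (card net) \<le> K"
      "\<And>t. t \<in> T \<Longrightarrow> \<exists>t'\<in>net. \<forall>f B. gradient_bounded f T B \<longrightarrow> \<bar>f t - f t'\<bar> \<le> 9 * B * \<delta>"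
    and \<delta>: "0 < \<delta>"
    and C: "\<And>x. x \<in> C \<Longrightarrow> (\<forall>i<n. x i \<in> G) \<Longrightarrow> \<exists>t\<in>T. 0 \<le> (\<Sum>i<n. u t (x i))"
    and C_sub: "C \<subseteq> space (PiM {..<n} (\<lambda>_. N))"
  shows "emeasure (PiM {..<n} (\<lambda>_. N)) C \<le>
    ennreal (K * exp (9 * real n * B * \<delta>) * exp (- (real n * \<rho>)) + real n * q)"
proof -
  interpret N: prob_space N by fact
  interpret NN: product_prob_space "\<lambda>_::nat. N" "{..<n}" by standard
  let ?N = "PiM {..<n} (\<lambda>_. N)"
  have space_N: "space N = UNIV" using sets_eq_imp_space_eq[OF sets_N] by simp
  note [measurable_cong] = sets_N
  \<comment> \<open>The score event may fail to be measurable; a measurable cover attains its outer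
    measure. Together with the exceptional set \<open>- G\<close> it forms the set \<open>V\<close>
    of bad observations.\<close>
  obtain W where W: "W \<in> sets N" "{x. S x > ennreal B} \<subseteq> W" "emeasure N W \<le> ennreal q"
    using outer_measure_of_attain[of "{x. S x > ennreal B}" N] tail by (auto simp: space_N)
  define V where "V = W \<union> - G"
  have V: "V \<in> sets N" using W G by (auto simp: V_def sets_N)
  have "emeasure N V \<le> emeasure N W + emeasure N (- G)"
    unfolding V_def using W G by (intro emeasure_subadditive) (auto simp: sets_N)
  then have emeasure_V: "emeasure N V \<le> ennreal q" using W G by simp
  \<comment> \<open>When \<open>t\<close> is replaced by its net point, a nonnegative sum can fall
    to this level. Since the Chernoff exponent \<open>z\<close> is at most 1, lowering the threshold
    costs no more than \<open>exp (- a)\<close>.\<close>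
  define a where "a = - (9 * real n * B * \<delta>)"
  define E where "E t = {x \<in> space ?N. a \<le> (\<Sum>i<n. u t (x i))}" for t
  define D where "D i = {x \<in> space ?N. x i \<in> V}" for i
  have E_meas: "E t \<in> sets ?N" if "t \<in> T" for t
  proof -
    have [measurable]: "u t \<in> borel_measurable N" using u_meas[OF that] by measurable
    show ?thesis unfolding E_def by measurable
  qed
  have D_meas: "D i \<in> sets ?N" if "i < n" for i
    unfolding D_def using V that by (intro sets_Collect_single) auto
  have E_le: "emeasure ?N (E t) \<le> ennreal (exp (9 * real n * B * \<delta>) * exp (- (real n * \<rho>)))" if t: "t \<in> T" for t
  proof -
    have [measurable]: "u t \<in> borel_measurable N" using u_meas[OF t] by measurable
    obtain z where z: "0 < z" "z \<le> 1" "(\<integral>\<^sup>+x. ennreal (exp (z * u t x)) \<partial>N) \<le> ennreal (exp (- \<rho>))"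
      using cramer[OF t] by auto
    have "emeasure ?N (E t) \<le> ennreal (exp (- z * a)) * (\<integral>\<^sup>+x. ennreal (exp (z * u t x)) \<partial>N) ^ n"
      unfolding E_def using z by (intro emeasure_PiM_sum_ge N) auto
    also have "\<dots> \<le> ennreal (exp (9 * real n * B * \<delta>)) * ennreal (exp (- \<rho>)) ^ n"
    proof (intro mult_mono power_mono z ennreal_leI)
      have "z * (9 * real n * B * \<delta>) \<le> 9 * real n * B * \<delta>"
        using z B \<delta> by (intro mult_left_le_one_le) auto
      then show "exp (- z * a) \<le> exp (9 * real n * B * \<delta>)"
        by (simp add: a_def)
    qed auto
    also have "\<dots> = ennreal (exp (9 * real n * B * \<delta>) * exp (- (real n * \<rho>)))"
      by (simp add: ennreal_power ennreal_mult flip: exp_of_nat_mult)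
    finally show ?thesis .
  qed
  have D_le: "emeasure ?N (D i) \<le> ennreal q" if "i < n" for i
  proof -
    have "emeasure ?N (D i) = emeasure (distr ?N N (\<lambda>x. x i)) V"
      using that V by (subst emeasure_distr) (auto simp: D_def intro!: arg_cong[where f="emeasure ?N"])
    also have "distr ?N N (\<lambda>x. x i) = N"
      using NN.PiM_component[of i] that by simp
    finally show ?thesis using emeasure_V by simp
  qed
  have "C \<subseteq> (\<Union>t\<in>net. E t) \<union> (\<Union>i<n. D i)"
  proof
    fix x assume x: "x \<in> C"
    show "x \<in> (\<Union>t\<in>net. E t) \<union> (\<Union>i<n. D i)"
    proof (cases "\<exists>i<n. x i \<in> V")
      case True
      then show ?thesis using x C_sub by (auto simp: D_def)
    next
      case False
      then have xi: "x i \<in> G" "S (x i) \<le> ennreal B" if "i < n" for i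
      proof -
        have "x i \<notin> V" using False that by auto
        then show "x i \<in> G" by (simp add: V_def)
        have "\<not> ennreal B < S (x i)" using \<open>x i \<notin> V\<close> W(2) by (auto simp: V_def)
        then show "S (x i) \<le> ennreal B" by simp
      qed
      then obtain t where t: "t \<in> T" "0 \<le> (\<Sum>i<n. u t (x i))"
        using C[OF x] by auto
      obtain t' where t': "t' \<in> net" "\<And>f B. gradient_bounded f T B \<Longrightarrow> \<bar>f t - f t'\<bar> \<le> 9 * B * \<delta>"
        using net(4)[OF t(1)] by blast
      have "u t (x i) - 9 * B * \<delta> \<le> u t' (x i)" if "i < n" for i
        using t'(2)[OF S[OF xi(1)[OF that] B xi(2)[OF that]]] by linarith
      then have "(\<Sum>i<n. u t (x i) - 9 * B * \<delta>) \<le> (\<Sum>i<n. u t' (x i))"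
        by (intro sum_mono) auto
      then have "a \<le> (\<Sum>i<n. u t' (x i))"
        using t(2) by (simp add: sum_subtractf a_def)
      then show ?thesis using t'(1) x C_sub by (auto simp: E_def)
    qed
  qed
  then have "emeasure ?N C \<le> emeasure ?N ((\<Union>t\<in>net. E t) \<union> (\<Union>i<n. D i))"
    using E_meas D_meas net by (intro emeasure_mono) (auto intro!: sets.Un sets.finite_UN)
  also have "\<dots> \<le> emeasure ?N (\<Union>t\<in>net. E t) + emeasure ?N (\<Union>i<n. D i)"
    using E_meas D_meas net by (intro emeasure_subadditive) (auto intro!: sets.finite_UN)
  also have "\<dots> \<le> (\<Sum>t\<in>net. emeasure ?N (E t)) + (\<Sum>i<n. emeasure ?N (D i))"
    using E_meas D_meas net by (intro add_mono emeasure_subadditive_finite) auto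
  also have "\<dots> \<le> (\<Sum>t\<in>net. ennreal (exp (9 * real n * B * \<delta>) * exp (- (real n * \<rho>)))) + (\<Sum>i<n. ennreal q)"
    using net by (intro add_mono sum_mono E_le D_le) auto
  also have "\<dots> = ennreal (real (card net) * (exp (9 * real n * B * \<delta>) * exp (- (real n * \<rho>))) + real n * q)"
    using q by (simp add: ennreal_of_nat_eq_real_of_nat flip: ennreal_mult ennreal_plus)
  also have "\<dots> \<le> ennreal (K * (exp (9 * real n * B * \<delta>) * exp (- (real n * \<rho>))) + real n * q)"
    using net by (intro ennreal_leI add_right_mono mult_right_mono) auto
  finally show ?thesis by (simp add: mult.assoc)
qed

section \<open>Separated families\<close>

text \<open>The set \<open>B\<close> consists of the measurable set \<open>A - N\<close> and a part
  of the null set \<open>N\<close>, so the completion measures it.\<close>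

lemma emeasure_completion_eq_AE:
  assumes A: "A \<in> sets M" and B: "B \<subseteq> space M" and AE: "AE x in M. x \<in> B \<longleftrightarrow> x \<in> A"
  shows "emeasure (completion M) B = emeasure M A"
proof -
  obtain N where N: "\<And>x. x \<in> space M - N \<Longrightarrow> x \<in> B \<longleftrightarrow> x \<in> A" "N \<in> null_sets M"
    using AE by (rule AE_E3) (rule that)
  have "B = (A - N) \<union> (B \<inter> N)"
    using N(1) B sets.sets_into_space[OF A] by blast
  then have "B \<in> sets (completion M)"
    using N(2) A by (intro sets_completionI[of B "A - N" "B \<inter> N" N]) auto
  then have "emeasure (completion M) B = emeasure (completion M) A"
    using A AE by (intro emeasure_eq_AE AE_completion) auto
  then show ?thesis
    using A by simp
qed

text \<open>The supremum over \<open>T\<close> is attained, and every neighbourhood of the maximizer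
  meets \<open>D\<close>, so values close to the maximum occur on \<open>D\<close>. With
  \<open>D\<close> countable this makes the maximal likelihood a measurable function of the
  sample.\<close>

lemma continuous_Sup_dense:
  fixes \<phi> :: "'a::topological_space \<Rightarrow> real"
  assumes T: "compact T" "T \<noteq> {}" and D: "D \<subseteq> T" "T \<subseteq> closure D" and \<phi>: "continuous_on T \<phi>"
  shows "(SUP t\<in>D. ennreal (\<phi> t)) = ennreal (SUP t\<in>T. \<phi> t)"
proof -
  obtain s where s: "s \<in> T" "\<And>t. t \<in> T \<Longrightarrow> \<phi> t \<le> \<phi> s"
    using continuous_attains_sup[OF T \<phi>] by auto
  then have sup: "(SUP t\<in>T. \<phi> t) = \<phi> s"
    by (intro cSup_eq_maximum) auto
  show ?thesis
    unfolding sup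
  proof (rule antisym)
    show "(SUP t\<in>D. ennreal (\<phi> t)) \<le> ennreal (\<phi> s)"
      using s D by (auto intro!: SUP_least ennreal_leI)
    show "ennreal (\<phi> s) \<le> (SUP t\<in>D. ennreal (\<phi> t))"
    proof (rule le_SUP_iff[THEN iffD2], safe)
      fix y assume y: "y < ennreal (\<phi> s)"
      have "continuous_on T (\<lambda>t. ennreal (\<phi> t))"
        using \<phi> by (rule continuous_on_ennreal)
      then obtain U where U: "open U" "U \<inter> T = (\<lambda>t. ennreal (\<phi> t)) -` {y<..} \<inter> T"
        unfolding continuous_on_open_invariant by (metis open_greaterThan)
      then have "s \<in> U" using s y by auto
      then have "U \<inter> D \<noteq> {}"
        using s D(2) U(1) open_Int_closure_eq_empty by blast
      then show "\<exists>t\<in>D. y < ennreal (\<phi> t)"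
        using U(2) D(1) by blast
    qed
  qed
qed

lemma ereal_tendstoI:
  assumes "\<And>e. 0 < e \<Longrightarrow> \<forall>\<^sub>F n in F. ereal (x - e) \<le> f n \<and> f n \<le> ereal (x + e)"
  shows "(f \<longlongrightarrow> ereal x) F"
proof (rule order_tendstoI)
  fix a assume "a < ereal x"
  then obtain y where y: "a < ereal y" "y < x"
    using ereal_dense2[of a "ereal x"] by auto
  show "\<forall>\<^sub>F n in F. a < f n"
    using assms[of "x - y"] y by (auto elim!: eventually_mono intro: less_le_trans)
next
  fix a assume "ereal x < a"
  then obtain y where y: "ereal y < a" "x < y"
    using ereal_dense2[of "ereal x" a] by auto
  show "\<forall>\<^sub>F n in F. f n < a"
    using assms[of "y - x"] y by (auto elim!: eventually_mono intro: le_less_trans)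
qed

lemma sets_law: "sets \<mu> = sets borel \<Longrightarrow> sets (law \<mu> f) = sets borel"
  by (simp add: law_def)

lemma prob_space_law:
  assumes "prob_density \<mu> f" shows "prob_space (law \<mu> f)"
  using assms unfolding prob_density_def law_def
  by (intro prob_spaceI) (auto simp: emeasure_density cong: nn_integral_cong)

lemma law_eq_density_loglr:
  assumes [measurable_cong]: "sets \<mu> = sets borel" and g: "prob_density \<mu> g" and h: "prob_density \<mu> h"
    and AE_g: "AE x in law \<mu> g. 0 < h x" and AE_h: "AE x in law \<mu> h. 0 < g x"
  shows "law \<mu> h = density (law \<mu> g) (\<lambda>x. ennreal (exp (loglr g h x)))"
proof -
  have [measurable]: "g \<in> borel_measurable \<mu>" "h \<in> borel_measurable \<mu>"
    and nonneg: "\<And>x. 0 \<le> g x" "\<And>x. 0 \<le> h x"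
    using g h by (auto simp: prob_density_def)
  have [measurable]: "loglr g h \<in> borel_measurable \<mu>"
    unfolding loglr_def[abs_def] by measurable
  have "AE x in \<mu>. 0 < ennreal (g x) \<longrightarrow> 0 < h x" "AE x in \<mu>. 0 < ennreal (h x) \<longrightarrow> 0 < g x"
    using AE_g AE_h unfolding law_def by (auto simp: AE_density)
  then have "AE x in \<mu>. ennreal (h x) = ennreal (g x) * ennreal (exp (loglr g h x))"
  proof eventually_elim
    case (elim x)
    show ?case
    proof (cases "g x = 0")
      \<comment> \<open>Here \<open>loglr\<close> contains the default value of \<open>ln 0\<close>,
        but mutual positivity forces \<open>h x = 0\<close> as well, and both sides vanish.\<close>
      case True
      then show ?thesis using elim nonneg(2)[of x] by force
    next
      case False
      then have "0 < g x" "0 < h x" using elim nonneg(1)[of x] by auto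
      then show ?thesis
        by (simp add: loglr_def exp_diff flip: ennreal_mult')
    qed
  qed
  then show ?thesis
    unfolding law_def by (subst density_density_eq) (auto intro!: density_cong)
qed

locale separated_families =
  fixes \<mu> :: "real measure"
    and \<Theta> :: "'a::euclidean_space set" and \<Gamma> :: "'b::euclidean_space set"
    and g :: "'a \<Rightarrow> real \<Rightarrow> real" and h :: "'b \<Rightarrow> real \<Rightarrow> real"
  assumes sets_\<mu>: "sets \<mu> = sets borel"
    and \<Theta>_nonempty: "\<Theta> \<noteq> {}" and \<Gamma>_nonempty: "\<Gamma> \<noteq> {}"
    and g_density: "\<And>\<theta>. \<theta> \<in> \<Theta> \<Longrightarrow> prob_density \<mu> (g \<theta>)"
    and h_density: "\<And>\<gamma>. \<gamma> \<in> \<Gamma> \<Longrightarrow> prob_density \<mu> (h \<gamma>)"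
    and mutually_ac: "\<And>f f'. f \<in> g ` \<Theta> \<union> h ` \<Gamma> \<Longrightarrow> f' \<in> g ` \<Theta> \<union> h ` \<Gamma> \<Longrightarrow>
           absolutely_continuous (law \<mu> f) (law \<mu> f')"
    and A1: "condition_A1 \<mu> \<Theta> \<Gamma> g h"
    and A2: "condition_A2 \<Theta> \<Gamma>"
    and A3: "condition_A3 \<mu> \<Theta> \<Gamma> g h"
begin

lemma density_family: "f \<in> g ` \<Theta> \<union> h ` \<Gamma> \<Longrightarrow> prob_density \<mu> f"
  using g_density h_density by auto

lemma g_measurable: "\<theta> \<in> \<Theta> \<Longrightarrow> g \<theta> \<in> borel_measurable borel"
  and h_measurable: "\<gamma> \<in> \<Gamma> \<Longrightarrow> h \<gamma> \<in> borel_measurable borel"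
proof -
  have eq: "borel_measurable \<mu> = (borel_measurable borel :: (real \<Rightarrow> real) set)"
    by (rule measurable_cong_sets[OF sets_\<mu> refl])
  show "\<theta> \<in> \<Theta> \<Longrightarrow> g \<theta> \<in> borel_measurable borel"
    using g_density[of \<theta>] eq by (simp add: prob_density_def)
  show "\<gamma> \<in> \<Gamma> \<Longrightarrow> h \<gamma> \<in> borel_measurable borel"
    using h_density[of \<gamma>] eq by (simp add: prob_density_def)
qed

section \<open>Observations at which all likelihoods are positive and differentiable\<close>

definition regular :: "real \<Rightarrow> bool" where
  "regular x \<longleftrightarrow> (\<forall>\<theta>\<in>\<Theta>. \<forall>\<gamma>\<in>\<Gamma>. 0 < g \<theta> x \<and> 0 < h \<gamma> x \<and>
     (\<lambda>\<theta>'. loglr (g \<theta>') (h \<gamma>) x) differentiable (at \<theta> within \<Theta>) \<and>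
     (\<lambda>\<gamma>'. loglr (g \<theta>) (h \<gamma>') x) differentiable (at \<gamma> within \<Gamma>))"

text \<open>The set of regular points need not be Borel, so a Borel null set is removed instead. It
  is obtained for one law, and mutual absolute continuity makes it null for all of them at
  once.\<close>

lemma ex_regular_set:
  "\<exists>G. G \<in> sets borel \<and> (\<forall>f \<in> g ` \<Theta> \<union> h ` \<Gamma>. emeasure (law \<mu> f) (- G) = 0) \<and> (\<forall>x\<in>G. regular x)"
proof -
  obtain f where f: "f \<in> g ` \<Theta> \<union> h ` \<Gamma>"
    using \<Theta>_nonempty by blast
  have "AE x in law \<mu> f. regular x"
    using A3 f unfolding condition_A3_def differentiable_loglr_def regular_def by blast
  then obtain N where *: "\<And>x. x \<in> space (law \<mu> f) - N \<Longrightarrow> regular x"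
    and N: "N \<in> null_sets (law \<mu> f)"
    by (rule AE_E3) (rule that)
  have "space (law \<mu> f) = UNIV"
    using sets_eq_imp_space_eq[OF sets_law[OF sets_\<mu>]] by simp
  moreover have "N \<in> null_sets (law \<mu> f')" if "f' \<in> g ` \<Theta> \<union> h ` \<Gamma>" for f'
    using mutually_ac[OF f that] N by (auto simp: absolutely_continuous_def)
  moreover have "N \<in> sets borel"
    using N sets_law[OF sets_\<mu>] by auto
  ultimately show ?thesis
    using * by (intro exI[of _ "- N"]) auto
qed

definition regular_set :: "real set" where
  "regular_set = (SOME G. G \<in> sets borel \<and>
     (\<forall>f \<in> g ` \<Theta> \<union> h ` \<Gamma>. emeasure (law \<mu> f) (- G) = 0) \<and> (\<forall>x\<in>G. regular x))"

lemma regular_set_borel: "regular_set \<in> sets borel"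
  and regular_set_null: "f \<in> g ` \<Theta> \<union> h ` \<Gamma> \<Longrightarrow> emeasure (law \<mu> f) (- regular_set) = 0"
  and regular_set_regular: "x \<in> regular_set \<Longrightarrow> regular x"
  using someI_ex[OF ex_regular_set] unfolding regular_set_def[symmetric] by blast+

lemma g_pos: "x \<in> regular_set \<Longrightarrow> \<theta> \<in> \<Theta> \<Longrightarrow> 0 < g \<theta> x"
  and h_pos: "x \<in> regular_set \<Longrightarrow> \<gamma> \<in> \<Gamma> \<Longrightarrow> 0 < h \<gamma> x"
  using regular_set_regular \<Theta>_nonempty \<Gamma>_nonempty unfolding regular_def by blast+

lemma differentiable_\<theta>: "x \<in> regular_set \<Longrightarrow> \<theta> \<in> \<Theta> \<Longrightarrow> \<gamma> \<in> \<Gamma> \<Longrightarrow>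
    (\<lambda>\<theta>'. loglr (g \<theta>') (h \<gamma>) x) differentiable (at \<theta> within \<Theta>)"
  and differentiable_\<gamma>: "x \<in> regular_set \<Longrightarrow> \<theta> \<in> \<Theta> \<Longrightarrow> \<gamma> \<in> \<Gamma> \<Longrightarrow>
    (\<lambda>\<gamma>'. loglr (g \<theta>) (h \<gamma>') x) differentiable (at \<gamma> within \<Gamma>)"
  using regular_set_regular unfolding regular_def by blast+

lemma AE_regular: "f \<in> g ` \<Theta> \<union> h ` \<Gamma> \<Longrightarrow> AE x in law \<mu> f. x \<in> regular_set"
  using regular_set_null[of f] regular_set_borel sets_law[OF sets_\<mu>, of f]
  by (intro AE_I'[of "- regular_set"]) auto

text \<open>Differentiability is given for log-likelihood ratios only. Fixing one \<gamma> and
  exponentiating recovers the density, which is positive at regular points.\<close>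

lemma continuous_g:
  assumes "x \<in> regular_set" shows "continuous_on \<Theta> (\<lambda>\<theta>. g \<theta> x)"
proof -
  obtain \<gamma> where \<gamma>: "\<gamma> \<in> \<Gamma>" using \<Gamma>_nonempty by auto
  have "continuous_on \<Theta> (\<lambda>\<theta>'. loglr (g \<theta>') (h \<gamma>) x)"
    using differentiable_\<theta>[OF assms _ \<gamma>]
    by (auto intro: differentiable_imp_continuous_on simp: differentiable_on_def)
  then have "continuous_on \<Theta> (\<lambda>\<theta>. exp (ln (h \<gamma> x) - loglr (g \<theta>) (h \<gamma>) x))"
    by (intro continuous_intros)
  then show ?thesis
    by (rule continuous_on_eq) (simp add: loglr_def g_pos[OF assms])
qed

lemma continuous_h:
  assumes "x \<in> regular_set" shows "continuous_on \<Gamma> (\<lambda>\<gamma>. h \<gamma> x)"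
proof -
  obtain \<theta> where \<theta>: "\<theta> \<in> \<Theta>" using \<Theta>_nonempty by auto
  have "continuous_on \<Gamma> (\<lambda>\<gamma>'. loglr (g \<theta>) (h \<gamma>') x)"
    using differentiable_\<gamma>[OF assms \<theta>]
    by (auto intro: differentiable_imp_continuous_on simp: differentiable_on_def)
  then have "continuous_on \<Gamma> (\<lambda>\<gamma>. exp (loglr (g \<theta>) (h \<gamma>) x + ln (g \<theta> x)))"
    by (intro continuous_intros)
  then show ?thesis
    by (rule continuous_on_eq) (simp add: loglr_def h_pos[OF assms])
qed

section \<open>Reduction to pairs of densities\<close>

lemma A1_pos:
  assumes "\<theta> \<in> \<Theta>" "\<gamma> \<in> \<Gamma>"
  shows "0 < eexpectation (law \<mu> (g \<theta>)) (\<lambda>x. ln (g \<theta> x) - ln (h \<gamma> x))"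
  using A1 unfolding condition_A1_def by (rule less_le_trans) (use assms in \<open>auto intro: INF_lower2\<close>)

text \<open>Otherwise A1 would assert that the expectation of 0 is positive. Hence the risk of
  \<open>h \<gamma>\<close> is its second-kind error.\<close>

lemma g_neq_h: "\<theta> \<in> \<Theta> \<Longrightarrow> \<gamma> \<in> \<Gamma> \<Longrightarrow> g \<theta> \<noteq> h \<gamma>"
  using A1_pos[of \<theta> \<gamma>] by (auto simp: eexpectation_def)

lemma law_h_eq:
  assumes "\<theta> \<in> \<Theta>" "\<gamma> \<in> \<Gamma>"
  shows "law \<mu> (h \<gamma>) = density (law \<mu> (g \<theta>)) (\<lambda>x. ennreal (exp (loglr (g \<theta>) (h \<gamma>) x)))"
proof (rule law_eq_density_loglr[OF sets_\<mu> g_density[OF assms(1)] h_density[OF assms(2)]])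
  show "AE x in law \<mu> (g \<theta>). 0 < h \<gamma> x" "AE x in law \<mu> (h \<gamma>). 0 < g \<theta> x"
    using AE_regular[of "g \<theta>"] AE_regular[of "h \<gamma>"] assms g_pos h_pos by (auto elim!: eventually_mono)
qed

lemma chernoff_pair:
  assumes "\<theta> \<in> \<Theta>" "\<gamma> \<in> \<Gamma>"
  shows "chernoff_pair (law \<mu> (g \<theta>)) (loglr (g \<theta>) (h \<gamma>))"
proof -
  interpret g: prob_space "law \<mu> (g \<theta>)" by (rule prob_space_law[OF g_density[OF assms(1)]])
  interpret h: prob_space "law \<mu> (h \<gamma>)" by (rule prob_space_law[OF h_density[OF assms(2)]])
  note [measurable_cong] = sets_law[OF sets_\<mu>]
  note [measurable] = g_measurable[OF assms(1)] h_measurable[OF assms(2)]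
  have meas [measurable]: "loglr (g \<theta>) (h \<gamma>) \<in> borel_measurable (law \<mu> (g \<theta>))"
    unfolding loglr_def[abs_def] by measurable
  show ?thesis
  proof
    have "1 = emeasure (law \<mu> (h \<gamma>)) (space (law \<mu> (h \<gamma>)))"
      by (rule h.emeasure_space_1[symmetric])
    also have "\<dots> = (\<integral>\<^sup>+x. ennreal (exp (loglr (g \<theta>) (h \<gamma>) x)) \<partial>law \<mu> (g \<theta>))"
      unfolding law_h_eq[OF assms] by (simp add: emeasure_density cong: nn_integral_cong)
    finally show "(\<integral>\<^sup>+x. ennreal (exp (loglr (g \<theta>) (h \<gamma>) x)) \<partial>law \<mu> (g \<theta>)) = 1" ..
    show "0 < eexpectation (law \<mu> (g \<theta>)) (\<lambda>x. - loglr (g \<theta>) (h \<gamma>) x)"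
      using A1_pos[OF assms] by (simp add: loglr_def)
  qed (rule meas)
qed

lemma Q_eq:
  assumes "\<theta> \<in> \<Theta>" "\<gamma> \<in> \<Gamma>"
  shows "chernoff_pair.Q (law \<mu> (g \<theta>)) (loglr (g \<theta>) (h \<gamma>)) = law \<mu> (h \<gamma>)"
  unfolding chernoff_pair.Q_def[OF chernoff_pair[OF assms]] law_h_eq[OF assms] ..

definition pair_index :: "'a \<Rightarrow> 'b \<Rightarrow> real" where
  "pair_index \<theta> \<gamma> = chernoff_pair.c (law \<mu> (g \<theta>)) (loglr (g \<theta>) (h \<gamma>))"

lemma chernoff_index_eq:
  assumes "\<theta> \<in> \<Theta>" "\<gamma> \<in> \<Gamma>"
  shows "chernoff_index \<mu> (g \<theta>) (h \<gamma>) = ereal (pair_index \<theta> \<gamma>)"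
  unfolding pair_index_def
  by (rule chernoff_pair.chernoff_index_eq[OF chernoff_pair[OF assms] refl refl Q_eq[OF assms, symmetric]])

lemma pair_index_nonneg: "\<theta> \<in> \<Theta> \<Longrightarrow> \<gamma> \<in> \<Gamma> \<Longrightarrow> 0 \<le> pair_index \<theta> \<gamma>"
  unfolding pair_index_def by (rule chernoff_pair.c_nonneg[OF chernoff_pair])

text \<open>The infimum is finite because the pair indices are real and nonnegative. The last
  conclusion supplies nearly minimizing pairs, as the lower bound requires.\<close>

lemma INF_chernoff_index:
  obtains r where "(INF \<theta>\<in>\<Theta>. INF \<gamma>\<in>\<Gamma>. chernoff_index \<mu> (g \<theta>) (h \<gamma>)) = ereal r"
    "\<And>\<theta> \<gamma>. \<theta> \<in> \<Theta> \<Longrightarrow> \<gamma> \<in> \<Gamma> \<Longrightarrow> r \<le> pair_index \<theta> \<gamma>"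
    "\<And>e. 0 < e \<Longrightarrow> \<exists>\<theta>\<in>\<Theta>. \<exists>\<gamma>\<in>\<Gamma>. pair_index \<theta> \<gamma> < r + e"
proof -
  let ?I = "INF \<theta>\<in>\<Theta>. INF \<gamma>\<in>\<Gamma>. chernoff_index \<mu> (g \<theta>) (h \<gamma>)"
  have lower: "?I \<le> ereal (pair_index \<theta> \<gamma>)" if "\<theta> \<in> \<Theta>" "\<gamma> \<in> \<Gamma>" for \<theta> \<gamma>
    using that chernoff_index_eq by (auto intro!: INF_lower2[of \<theta>] INF_lower2[of \<gamma>])
  have "0 \<le> ?I"
    using pair_index_nonneg chernoff_index_eq by (auto intro!: INF_greatest)
  moreover obtain \<theta> \<gamma> where "\<theta> \<in> \<Theta>" "\<gamma> \<in> \<Gamma>"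
    using \<Theta>_nonempty \<Gamma>_nonempty by blast
  ultimately obtain r where r: "?I = ereal r"
    using lower[of \<theta> \<gamma>] by (cases ?I) auto
  show ?thesis
  proof (rule that[OF r])
    show "r \<le> pair_index \<theta> \<gamma>" if "\<theta> \<in> \<Theta>" "\<gamma> \<in> \<Gamma>" for \<theta> \<gamma>
      using lower[OF that] r by simp
    show "\<exists>\<theta>\<in>\<Theta>. \<exists>\<gamma>\<in>\<Gamma>. pair_index \<theta> \<gamma> < r + e" if "0 < e" for e
    proof -
      have "?I < ereal (r + e)" using r that by simp
      then show ?thesis
        by (auto simp: INF_less_iff chernoff_index_eq)
    qed
  qed
qed

section \<open>Laws of samples and risks\<close>

lemma sets_sample_law: "sets (sample_law \<mu> f n) = sets (sample_space n)"
  unfolding sample_law_def sample_space_def by (intro sets_PiM_cong) (auto simp: sets_law[OF sets_\<mu>])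

lemma space_sample_law: "space (sample_law \<mu> f n) = space (sample_space n)"
  by (rule sets_eq_imp_space_eq[OF sets_sample_law])

lemma AE_sample_regular:
  assumes "f \<in> g ` \<Theta> \<union> h ` \<Gamma>"
  shows "AE x in sample_law \<mu> f n. \<forall>i<n. x i \<in> regular_set"
proof -
  have "AE x in sample_law \<mu> f n. \<forall>i\<in>{..<n}. x i \<in> regular_set"
    unfolding sample_law_def
    by (intro AE_finite_allI AE_PiM_component AE_regular assms prob_space_law density_family) auto
  then show ?thesis by (simp only: Ball_def lessThan_iff)
qed

lemma risk_g:
  "\<theta> \<in> \<Theta> \<Longrightarrow> C \<in> sets (sample_space n) \<Longrightarrow> risk \<mu> (g ` \<Theta>) n C (g \<theta>) = emeasure (sample_law \<mu> (g \<theta>) n) C"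
  by (simp add: risk_def sets_sample_law)

lemma risk_h:
  assumes "\<gamma> \<in> \<Gamma>" "C \<in> sets (sample_space n)"
  shows "risk \<mu> (g ` \<Theta>) n C (h \<gamma>) = emeasure (sample_law \<mu> (h \<gamma>) n) (space (sample_space n) - C)"
proof -
  have "h \<gamma> \<notin> g ` \<Theta>" using g_neq_h[OF _ assms(1)] by (metis imageE)
  moreover have "space (sample_space n) - C \<in> sets (sample_space n)"
    using assms by auto
  ultimately show ?thesis
    by (simp add: risk_def sets_sample_law)
qed

section \<open>Error bounds uniform in the parameters\<close>

lemma score_tail:
  obtains \<eta> x0 where "0 < \<eta>"
    "\<And>x f. x0 < x \<Longrightarrow> f \<in> g ` \<Theta> \<union> h ` \<Gamma> \<Longrightarrow>
      outer_measure_of (law \<mu> f) {y. score1 \<Theta> \<Gamma> g h y > ennreal x} \<le> ennreal (exp (- (ln x powr (1 + \<eta>)))) \<and>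
      outer_measure_of (law \<mu> f) {y. score2 \<Theta> \<Gamma> g h y > ennreal x} \<le> ennreal (exp (- (ln x powr (1 + \<eta>))))"
proof -
  obtain \<eta> x0 where \<eta>: "0 < \<eta>" and
    *: "\<forall>x>x0. \<forall>S \<in> {score1 \<Theta> \<Gamma> g h, score2 \<Theta> \<Gamma> g h}.
        (SUP \<theta>\<in>\<Theta>. SUP \<gamma>\<in>\<Gamma>.
           max (outer_measure_of (law \<mu> (g \<theta>)) {y. S y > ennreal x})
               (outer_measure_of (law \<mu> (h \<gamma>)) {y. S y > ennreal x}))
        \<le> ennreal (exp (- ((ln x) powr (1 + \<eta>))))"
    using A3 unfolding condition_A3_def by blast
  have "outer_measure_of (law \<mu> f) {y. S y > ennreal x} \<le> ennreal (exp (- (ln x powr (1 + \<eta>))))"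
    if x: "x0 < x" and f: "f \<in> g ` \<Theta> \<union> h ` \<Gamma>" and S: "S \<in> {score1 \<Theta> \<Gamma> g h, score2 \<Theta> \<Gamma> g h}" for x f S
  proof -
    let ?m = "\<lambda>f. outer_measure_of (law \<mu> f) {y. S y > ennreal x}"
    obtain \<theta> \<gamma> where "\<theta> \<in> \<Theta>" "\<gamma> \<in> \<Gamma>" "?m f \<le> max (?m (g \<theta>)) (?m (h \<gamma>))"
      using f \<Theta>_nonempty \<Gamma>_nonempty by (auto intro: max.cobounded1 max.cobounded2)
    then have "?m f \<le> (SUP \<theta>\<in>\<Theta>. SUP \<gamma>\<in>\<Gamma>. max (?m (g \<theta>)) (?m (h \<gamma>)))"
      by (intro SUP_upper2[of \<theta>] SUP_upper2[of \<gamma>])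
    also have "\<dots> \<le> ennreal (exp (- (ln x powr (1 + \<eta>))))"
      using * x S by blast
    finally show ?thesis .
  qed
  with \<eta> show ?thesis
    by (intro that[of \<eta> x0]) auto
qed

lemma gradient_bounded_score1:
  assumes "x \<in> regular_set" "\<gamma> \<in> \<Gamma>" "0 \<le> B" "score1 \<Theta> \<Gamma> g h x \<le> ennreal B"
  shows "gradient_bounded (\<lambda>\<theta>. loglr (g \<theta>) (h \<gamma>) x) \<Theta> B"
proof (rule gradient_boundedI)
  fix \<theta> assume \<theta>: "\<theta> \<in> \<Theta>"
  show "(\<lambda>\<theta>. loglr (g \<theta>) (h \<gamma>) x) differentiable (at \<theta> within \<Theta>)"
    using assms \<theta> by (intro differentiable_\<theta>)
  have "ennreal (norm (gradient_within (\<lambda>\<theta>. loglr (g \<theta>) (h \<gamma>) x) \<Theta> \<theta>)) \<le> score1 \<Theta> \<Gamma> g h x"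
    unfolding score1_def using \<theta> assms by (intro SUP_upper2[of \<theta>] SUP_upper2[of \<gamma>]) auto
  also have "\<dots> \<le> ennreal B" by fact
  finally show "norm (gradient_within (\<lambda>\<theta>. loglr (g \<theta>) (h \<gamma>) x) \<Theta> \<theta>) \<le> B"
    using assms by simp
qed

lemma gradient_bounded_score2:
  assumes "x \<in> regular_set" "\<theta> \<in> \<Theta>" "0 \<le> B" "score2 \<Theta> \<Gamma> g h x \<le> ennreal B"
  shows "gradient_bounded (\<lambda>\<gamma>. loglr (g \<theta>) (h \<gamma>) x) \<Gamma> B"
proof (rule gradient_boundedI)
  fix \<gamma> assume \<gamma>: "\<gamma> \<in> \<Gamma>"
  show "(\<lambda>\<gamma>. loglr (g \<theta>) (h \<gamma>) x) differentiable (at \<gamma> within \<Gamma>)"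
    using assms \<gamma> by (intro differentiable_\<gamma>)
  have "ennreal (norm (gradient_within (\<lambda>\<gamma>. loglr (g \<theta>) (h \<gamma>) x) \<Gamma> \<gamma>)) \<le> score2 \<Theta> \<Gamma> g h x"
    unfolding score2_def using \<gamma> assms by (intro SUP_upper2[of \<theta>] SUP_upper2[of \<gamma>]) auto
  also have "\<dots> \<le> ennreal B" by fact
  finally show "norm (gradient_within (\<lambda>\<gamma>. loglr (g \<theta>) (h \<gamma>) x) \<Gamma> \<gamma>) \<le> B"
    using assms by simp
qed

lemma loglr_measurable:
  assumes "\<theta> \<in> \<Theta>" "\<gamma> \<in> \<Gamma>"
  shows "loglr (g \<theta>) (h \<gamma>) \<in> borel_measurable borel"
proof -
  note [measurable] = g_measurable[OF assms(1)] h_measurable[OF assms(2)]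
  show ?thesis unfolding loglr_def[abs_def] by measurable
qed

lemma cramer_bound_g:
  assumes "\<theta> \<in> \<Theta>" "\<gamma> \<in> \<Gamma>" "r \<le> pair_index \<theta> \<gamma>"
  shows "\<exists>z. 0 < z \<and> z \<le> 1 \<and> (\<integral>\<^sup>+x. ennreal (exp (z * loglr (g \<theta>) (h \<gamma>) x)) \<partial>law \<mu> (g \<theta>)) \<le> ennreal (exp (- r))"
proof -
  interpret p: chernoff_pair "law \<mu> (g \<theta>)" "loglr (g \<theta>) (h \<gamma>)" by (rule chernoff_pair[OF assms(1,2)])
  have "p.emgf p.zmin = ennreal (exp (- pair_index \<theta> \<gamma>))"
    using p.zmin p.M_zmin by (simp add: p.emgf_eq_M pair_index_def)
  also have "\<dots> \<le> ennreal (exp (- r))"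
    using assms by (intro ennreal_leI) simp
  finally show ?thesis
    using p.zmin by (intro exI[of _ p.zmin]) (auto simp: p.emgf_def)
qed

text \<open>The exponent is \<open>1 - p.zmin\<close>: a moment of order \<open>p.zmin - 1\<close>
  under h is the moment of order \<open>p.zmin\<close> under g, so both errors share the
  bound.\<close>

lemma cramer_bound_h:
  assumes "\<theta> \<in> \<Theta>" "\<gamma> \<in> \<Gamma>" "r \<le> pair_index \<theta> \<gamma>"
  shows "\<exists>z. 0 < z \<and> z \<le> 1 \<and> (\<integral>\<^sup>+x. ennreal (exp (z * - loglr (g \<theta>) (h \<gamma>) x)) \<partial>law \<mu> (h \<gamma>)) \<le> ennreal (exp (- r))"
proof -
  interpret p: chernoff_pair "law \<mu> (g \<theta>)" "loglr (g \<theta>) (h \<gamma>)" by (rule chernoff_pair[OF assms(1,2)])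
  have "(\<integral>\<^sup>+x. ennreal (exp ((p.zmin - 1) * loglr (g \<theta>) (h \<gamma>) x)) \<partial>law \<mu> (h \<gamma>)) = p.emgf p.zmin"
    unfolding Q_eq[OF assms(1,2), symmetric] p.emgf_Q by simp
  also have "\<dots> = ennreal (exp (- pair_index \<theta> \<gamma>))"
    using p.zmin p.M_zmin by (simp add: p.emgf_eq_M pair_index_def)
  also have "\<dots> \<le> ennreal (exp (- r))"
    using assms by (intro ennreal_leI) simp
  finally show ?thesis
    using p.zmin by (intro exI[of _ "1 - p.zmin"]) (auto simp: algebra_simps)
qed

text \<open>The true \<theta> stays fixed and only \<gamma> is discretized, so the relevant
  gradients are those in \<gamma>. The net, the score tail and \<open>r\<close> do not depend on
  \<theta> or \<open>C\<close>, hence a single n serves all of them. Samples with an irregular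
  coordinate are left unrestricted, since they form a null set.\<close>

lemma type_I_error_eventually_le:
  assumes r: "\<forall>\<theta>\<in>\<Theta>. \<forall>\<gamma>\<in>\<Gamma>. r \<le> pair_index \<theta> \<gamma>" and e: "0 < e"
  shows "\<forall>\<^sub>F n in sequentially. \<forall>\<theta>\<in>\<Theta>. \<forall>C\<in>sets (sample_space n).
    (\<forall>x\<in>C. (\<forall>i<n. x i \<in> regular_set) \<longrightarrow> (\<exists>\<gamma>\<in>\<Gamma>. 0 \<le> (\<Sum>i<n. loglr (g \<theta>) (h \<gamma>) (x i)))) \<longrightarrow>
    emeasure (sample_law \<mu> (g \<theta>) n) C \<le> ennreal (exp (- (real n * (r - e))))"
proof -
  obtain \<eta> x0 where \<eta>: "0 < \<eta>" and tail: "\<And>x f. x0 < x \<Longrightarrow> f \<in> g ` \<Theta> \<union> h ` \<Gamma> \<Longrightarrow>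
      outer_measure_of (law \<mu> f) {y. score1 \<Theta> \<Gamma> g h y > ennreal x} \<le> ennreal (exp (- (ln x powr (1 + \<eta>)))) \<and>
      outer_measure_of (law \<mu> f) {y. score2 \<Theta> \<Gamma> g h y > ennreal x} \<le> ennreal (exp (- (ln x powr (1 + \<eta>))))"
    using score_tail by blast
  obtain A where A: "0 \<le> A" and net:
    "\<And>\<delta>. 0 < \<delta> \<Longrightarrow> \<delta> \<le> 1 \<Longrightarrow> \<exists>N. finite N \<and> N \<subseteq> \<Gamma> \<and> real (card N) \<le> A / \<delta> ^ DIM('b) \<and>
       (\<forall>t\<in>\<Gamma>. \<exists>t'\<in>N. \<forall>f B. gradient_bounded f \<Gamma> B \<longrightarrow> \<bar>f t - f t'\<bar> \<le> 9 * B * \<delta>)"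
    by (rule compact_C1_boundary_net[of \<Gamma>]) (use A2 that in \<open>auto simp: condition_A2_def\<close>)
  show ?thesis
    using net_parameters_eventually[OF A e \<eta>, of x0 "DIM('b)" r]
  proof eventually_elim
    case (elim n)
    then obtain B \<delta> where B: "x0 < B" "0 < B" and \<delta>: "0 < \<delta>" "\<delta> \<le> 1" and
      le: "A / \<delta> ^ DIM('b) * exp (9 * real n * B * \<delta>) * exp (- (real n * r)) + real n * exp (- (ln B powr (1 + \<eta>)))
        \<le> exp (- (real n * (r - e)))"
      by blast
    obtain N where N: "finite N" "N \<subseteq> \<Gamma>" "real (card N) \<le> A / \<delta> ^ DIM('b)"
       "\<And>t. t \<in> \<Gamma> \<Longrightarrow> \<exists>t'\<in>N. \<forall>f B. gradient_bounded f \<Gamma> B \<longrightarrow> \<bar>f t - f t'\<bar> \<le> 9 * B * \<delta>"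
      using net[OF \<delta>] by blast
    show ?case
    proof (intro ballI impI)
      fix \<theta> C assume \<theta>: "\<theta> \<in> \<Theta>" and C: "C \<in> sets (sample_space n)"
        "\<forall>x\<in>C. (\<forall>i<n. x i \<in> regular_set) \<longrightarrow> (\<exists>\<gamma>\<in>\<Gamma>. 0 \<le> (\<Sum>i<n. loglr (g \<theta>) (h \<gamma>) (x i)))"
      have "emeasure (PiM {..<n} (\<lambda>_. law \<mu> (g \<theta>))) C \<le>
        ennreal (A / \<delta> ^ DIM('b) * exp (9 * real n * B * \<delta>) * exp (- (real n * r)) + real n * exp (- (ln B powr (1 + \<eta>))))"
      proof (rule emeasure_exceedance_le[where T=\<Gamma> and u="\<lambda>\<gamma>. loglr (g \<theta>) (h \<gamma>)" and G=regular_set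
          and S="score2 \<Theta> \<Gamma> g h" and net=N])
        show "outer_measure_of (law \<mu> (g \<theta>)) {x. score2 \<Theta> \<Gamma> g h x > ennreal B} \<le> ennreal (exp (- (ln B powr (1 + \<eta>))))"
          using tail[OF B(1), of "g \<theta>"] \<theta> by blast
        show "C \<subseteq> space (PiM {..<n} (\<lambda>_. law \<mu> (g \<theta>)))"
          using sets.sets_into_space[OF C(1)] space_sample_law[of "g \<theta>" n] by (simp add: sample_law_def)
        show "\<exists>\<gamma>\<in>\<Gamma>. 0 \<le> (\<Sum>i<n. loglr (g \<theta>) (h \<gamma>) (x i))" if "x \<in> C" "\<forall>i<n. x i \<in> regular_set" for x
          using C(2) that by blast
        show "emeasure (law \<mu> (g \<theta>)) (- regular_set) = 0"
          using \<theta> by (intro regular_set_null) auto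
      qed (use \<theta> r \<delta> B N prob_space_law[OF g_density] sets_law[OF sets_\<mu>] loglr_measurable cramer_bound_g
            regular_set_borel gradient_bounded_score2 in auto)
      also have "\<dots> \<le> ennreal (exp (- (real n * (r - e))))"
        using le by (rule ennreal_leI)
      finally show "emeasure (sample_law \<mu> (g \<theta>) n) C \<le> ennreal (exp (- (real n * (r - e))))"
        by (simp add: sample_law_def)
    qed
  qed
qed

text \<open>The same argument with the families exchanged: the net lies in \<Theta>, and the sign of
  the log-likelihood ratio is reversed to turn the error into an upper exceedance.\<close>

lemma type_II_error_eventually_le:
  assumes r: "\<forall>\<theta>\<in>\<Theta>. \<forall>\<gamma>\<in>\<Gamma>. r \<le> pair_index \<theta> \<gamma>" and e: "0 < e"
  shows "\<forall>\<^sub>F n in sequentially. \<forall>\<gamma>\<in>\<Gamma>. \<forall>C\<in>sets (sample_space n).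
    (\<forall>x\<in>C. (\<forall>i<n. x i \<in> regular_set) \<longrightarrow> (\<exists>\<theta>\<in>\<Theta>. (\<Sum>i<n. loglr (g \<theta>) (h \<gamma>) (x i)) \<le> 0)) \<longrightarrow>
    emeasure (sample_law \<mu> (h \<gamma>) n) C \<le> ennreal (exp (- (real n * (r - e))))"
proof -
  obtain \<eta> x0 where \<eta>: "0 < \<eta>" and tail: "\<And>x f. x0 < x \<Longrightarrow> f \<in> g ` \<Theta> \<union> h ` \<Gamma> \<Longrightarrow>
      outer_measure_of (law \<mu> f) {y. score1 \<Theta> \<Gamma> g h y > ennreal x} \<le> ennreal (exp (- (ln x powr (1 + \<eta>)))) \<and>
      outer_measure_of (law \<mu> f) {y. score2 \<Theta> \<Gamma> g h y > ennreal x} \<le> ennreal (exp (- (ln x powr (1 + \<eta>))))"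
    using score_tail by blast
  obtain A where A: "0 \<le> A" and net:
    "\<And>\<delta>. 0 < \<delta> \<Longrightarrow> \<delta> \<le> 1 \<Longrightarrow> \<exists>N. finite N \<and> N \<subseteq> \<Theta> \<and> real (card N) \<le> A / \<delta> ^ DIM('a) \<and>
       (\<forall>t\<in>\<Theta>. \<exists>t'\<in>N. \<forall>f B. gradient_bounded f \<Theta> B \<longrightarrow> \<bar>f t - f t'\<bar> \<le> 9 * B * \<delta>)"
    by (rule compact_C1_boundary_net[of \<Theta>]) (use A2 that in \<open>auto simp: condition_A2_def\<close>)
  show ?thesis
    using net_parameters_eventually[OF A e \<eta>, of x0 "DIM('a)" r]
  proof eventually_elim
    case (elim n)
    then obtain B \<delta> where B: "x0 < B" "0 < B" and \<delta>: "0 < \<delta>" "\<delta> \<le> 1" and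
      le: "A / \<delta> ^ DIM('a) * exp (9 * real n * B * \<delta>) * exp (- (real n * r)) + real n * exp (- (ln B powr (1 + \<eta>)))
        \<le> exp (- (real n * (r - e)))"
      by blast
    obtain N where N: "finite N" "N \<subseteq> \<Theta>" "real (card N) \<le> A / \<delta> ^ DIM('a)"
       "\<And>t. t \<in> \<Theta> \<Longrightarrow> \<exists>t'\<in>N. \<forall>f B. gradient_bounded f \<Theta> B \<longrightarrow> \<bar>f t - f t'\<bar> \<le> 9 * B * \<delta>"
      using net[OF \<delta>] by blast
    show ?case
    proof (intro ballI impI)
      fix \<gamma> C assume \<gamma>: "\<gamma> \<in> \<Gamma>" and C: "C \<in> sets (sample_space n)"
        "\<forall>x\<in>C. (\<forall>i<n. x i \<in> regular_set) \<longrightarrow> (\<exists>\<theta>\<in>\<Theta>. (\<Sum>i<n. loglr (g \<theta>) (h \<gamma>) (x i)) \<le> 0)"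
      have "emeasure (PiM {..<n} (\<lambda>_. law \<mu> (h \<gamma>))) C \<le>
        ennreal (A / \<delta> ^ DIM('a) * exp (9 * real n * B * \<delta>) * exp (- (real n * r)) + real n * exp (- (ln B powr (1 + \<eta>))))"
      proof (rule emeasure_exceedance_le[where T=\<Theta> and u="\<lambda>\<theta> x. - loglr (g \<theta>) (h \<gamma>) x" and G=regular_set
          and S="score1 \<Theta> \<Gamma> g h" and net=N])
        show "outer_measure_of (law \<mu> (h \<gamma>)) {x. score1 \<Theta> \<Gamma> g h x > ennreal B} \<le> ennreal (exp (- (ln B powr (1 + \<eta>))))"
          using tail[OF B(1), of "h \<gamma>"] \<gamma> by blast
        show "C \<subseteq> space (PiM {..<n} (\<lambda>_. law \<mu> (h \<gamma>)))"
          using sets.sets_into_space[OF C(1)] space_sample_law[of "h \<gamma>" n] by (simp add: sample_law_def)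
        show "\<exists>\<theta>\<in>\<Theta>. 0 \<le> (\<Sum>i<n. - loglr (g \<theta>) (h \<gamma>) (x i))" if "x \<in> C" "\<forall>i<n. x i \<in> regular_set" for x
          using C(2) that by (simp add: sum_negf)
        show "emeasure (law \<mu> (h \<gamma>)) (- regular_set) = 0"
          using \<gamma> by (intro regular_set_null) auto
        show "gradient_bounded (\<lambda>\<theta>. - loglr (g \<theta>) (h \<gamma>) x) \<Theta> B"
          if "x \<in> regular_set" "0 \<le> B" "score1 \<Theta> \<Gamma> g h x \<le> ennreal B" for x B
          using that \<gamma> by (intro gradient_bounded_uminus gradient_bounded_score1)
        show "(\<lambda>x. - loglr (g \<theta>) (h \<gamma>) x) \<in> borel_measurable borel" if "\<theta> \<in> \<Theta>" for \<theta>
          using loglr_measurable[OF that \<gamma>] by measurable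
        show "\<exists>z. 0 < z \<and> z \<le> 1 \<and> (\<integral>\<^sup>+x. ennreal (exp (z * - loglr (g \<theta>) (h \<gamma>) x)) \<partial>law \<mu> (h \<gamma>)) \<le> ennreal (exp (- r))"
          if "\<theta> \<in> \<Theta>" for \<theta>
          using that \<gamma> r by (intro cramer_bound_h) auto
      qed (use \<gamma> \<delta> B N prob_space_law[OF h_density] sets_law[OF sets_\<mu>] regular_set_borel in auto)
      also have "\<dots> \<le> ennreal (exp (- (real n * (r - e))))"
        using le by (rule ennreal_leI)
      finally show "emeasure (sample_law \<mu> (h \<gamma>) n) C \<le> ennreal (exp (- (real n * (r - e))))"
        by (simp add: sample_law_def)
    qed
  qed
qed

section \<open>A Borel version of the likelihood ratio region\<close>

definition dense_\<Theta> :: "'a set" where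
  "dense_\<Theta> = (SOME D. countable D \<and> D \<subseteq> \<Theta> \<and> \<Theta> \<subseteq> closure D)"

definition dense_\<Gamma> :: "'b set" where
  "dense_\<Gamma> = (SOME D. countable D \<and> D \<subseteq> \<Gamma> \<and> \<Gamma> \<subseteq> closure D)"

lemma dense_\<Theta>: "countable dense_\<Theta>" "dense_\<Theta> \<subseteq> \<Theta>" "\<Theta> \<subseteq> closure dense_\<Theta>"
  using someI_ex[of "\<lambda>D. countable D \<and> D \<subseteq> \<Theta> \<and> \<Theta> \<subseteq> closure D"] separable[of \<Theta>]
  unfolding dense_\<Theta>_def by metis+

lemma dense_\<Gamma>: "countable dense_\<Gamma>" "dense_\<Gamma> \<subseteq> \<Gamma>" "\<Gamma> \<subseteq> closure dense_\<Gamma>"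
  using someI_ex[of "\<lambda>D. countable D \<and> D \<subseteq> \<Gamma> \<and> \<Gamma> \<subseteq> closure D"] separable[of \<Gamma>]
  unfolding dense_\<Gamma>_def by metis+

text \<open>Suprema over countable dense sets make this region Borel; it agrees with \<open>GLR_region\<close> wherever
  the likelihoods are continuous in the parameters.\<close>

definition GLR_version :: "nat \<Rightarrow> (nat \<Rightarrow> real) set" where
  "GLR_version n = {x \<in> space (sample_space n).
    (SUP \<theta>\<in>dense_\<Theta>. ennreal (\<Prod>i<n. g \<theta> (x i))) < (SUP \<gamma>\<in>dense_\<Gamma>. ennreal (\<Prod>i<n. h \<gamma> (x i)))}"

text \<open>Both suprema are over countable sets, and in \<open>ennreal\<close> they need no
  boundedness condition.\<close>

lemma GLR_version_sets [measurable]: "GLR_version n \<in> sets (sample_space n)"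
proof -
  have *: "(\<lambda>x. ennreal (\<Prod>i<n. f (x i))) \<in> borel_measurable (sample_space n)"
    if [measurable]: "f \<in> borel_measurable borel" for f :: "real \<Rightarrow> real"
    unfolding sample_space_def by measurable
  have "(\<lambda>x. SUP \<theta>\<in>dense_\<Theta>. ennreal (\<Prod>i<n. g \<theta> (x i))) \<in> borel_measurable (sample_space n)"
    "(\<lambda>x. SUP \<gamma>\<in>dense_\<Gamma>. ennreal (\<Prod>i<n. h \<gamma> (x i))) \<in> borel_measurable (sample_space n)"
    using dense_\<Theta> dense_\<Gamma> g_measurable h_measurable
    by (auto intro!: borel_measurable_SUP * )
  then show ?thesis
    unfolding GLR_version_def by measurable
qed

section \<open>Likelihoods at a sample of regular points\<close>

context
  fixes x :: "nat \<Rightarrow> real" and n :: nat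
  assumes x: "\<And>i. i < n \<Longrightarrow> x i \<in> regular_set"
begin

lemma continuous_likelihoods:
  "continuous_on \<Theta> (\<lambda>\<theta>. \<Prod>i<n. g \<theta> (x i))" "continuous_on \<Gamma> (\<lambda>\<gamma>. \<Prod>i<n. h \<gamma> (x i))"
  using x by (auto intro!: continuous_on_prod continuous_g continuous_h)

lemma g_likelihood_sup:
  shows "\<exists>\<theta>\<in>\<Theta>. (SUP \<theta>\<in>\<Theta>. \<Prod>i<n. g \<theta> (x i)) = (\<Prod>i<n. g \<theta> (x i))"
    and "\<theta> \<in> \<Theta> \<Longrightarrow> (\<Prod>i<n. g \<theta> (x i)) \<le> (SUP \<theta>\<in>\<Theta>. \<Prod>i<n. g \<theta> (x i))"
proof -
  have "compact \<Theta>" using A2 by (simp add: condition_A2_def)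
  then obtain \<theta>m where m: "\<theta>m \<in> \<Theta>" "\<forall>\<theta>\<in>\<Theta>. (\<Prod>i<n. g \<theta> (x i)) \<le> (\<Prod>i<n. g \<theta>m (x i))"
    using continuous_attains_sup[OF _ \<Theta>_nonempty continuous_likelihoods(1)] by blast
  then have sup: "(SUP \<theta>\<in>\<Theta>. \<Prod>i<n. g \<theta> (x i)) = (\<Prod>i<n. g \<theta>m (x i))"
    by (intro cSup_eq_maximum) auto
  show "\<exists>\<theta>\<in>\<Theta>. (SUP \<theta>\<in>\<Theta>. \<Prod>i<n. g \<theta> (x i)) = (\<Prod>i<n. g \<theta> (x i))"
    using sup m(1) by (rule bexI)
  show "(\<Prod>i<n. g \<theta> (x i)) \<le> (SUP \<theta>\<in>\<Theta>. \<Prod>i<n. g \<theta> (x i))" if "\<theta> \<in> \<Theta>"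
    unfolding sup using m(2) that by (rule bspec)
qed

lemma h_likelihood_sup:
  shows "\<exists>\<gamma>\<in>\<Gamma>. (SUP \<gamma>\<in>\<Gamma>. \<Prod>i<n. h \<gamma> (x i)) = (\<Prod>i<n. h \<gamma> (x i))"
    and "\<gamma> \<in> \<Gamma> \<Longrightarrow> (\<Prod>i<n. h \<gamma> (x i)) \<le> (SUP \<gamma>\<in>\<Gamma>. \<Prod>i<n. h \<gamma> (x i))"
proof -
  have "compact \<Gamma>" using A2 by (simp add: condition_A2_def)
  then obtain \<gamma>m where m: "\<gamma>m \<in> \<Gamma>" "\<forall>\<gamma>\<in>\<Gamma>. (\<Prod>i<n. h \<gamma> (x i)) \<le> (\<Prod>i<n. h \<gamma>m (x i))"
    using continuous_attains_sup[OF _ \<Gamma>_nonempty continuous_likelihoods(2)] by blast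
  then have sup: "(SUP \<gamma>\<in>\<Gamma>. \<Prod>i<n. h \<gamma> (x i)) = (\<Prod>i<n. h \<gamma>m (x i))"
    by (intro cSup_eq_maximum) auto
  show "\<exists>\<gamma>\<in>\<Gamma>. (SUP \<gamma>\<in>\<Gamma>. \<Prod>i<n. h \<gamma> (x i)) = (\<Prod>i<n. h \<gamma> (x i))"
    using sup m(1) by (rule bexI)
  show "(\<Prod>i<n. h \<gamma> (x i)) \<le> (SUP \<gamma>\<in>\<Gamma>. \<Prod>i<n. h \<gamma> (x i))" if "\<gamma> \<in> \<Gamma>"
    unfolding sup using m(2) that by (rule bspec)
qed

lemma likelihood_pos:
  "\<theta> \<in> \<Theta> \<Longrightarrow> 0 < (\<Prod>i<n. g \<theta> (x i))" "\<gamma> \<in> \<Gamma> \<Longrightarrow> 0 < (\<Prod>i<n. h \<gamma> (x i))"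
  using x by (auto intro!: prod_pos g_pos h_pos)

lemma sum_loglr:
  assumes "\<theta> \<in> \<Theta>" "\<gamma> \<in> \<Gamma>"
  shows "(\<Sum>i<n. loglr (g \<theta>) (h \<gamma>) (x i)) = ln (\<Prod>i<n. h \<gamma> (x i)) - ln (\<Prod>i<n. g \<theta> (x i))"
proof -
  have "ln (\<Prod>i<n. h \<gamma> (x i)) = (\<Sum>i<n. ln (h \<gamma> (x i)))" "ln (\<Prod>i<n. g \<theta> (x i)) = (\<Sum>i<n. ln (g \<theta> (x i)))"
    using g_pos[OF x assms(1)] h_pos[OF x assms(2)] by (force intro!: ln_prod)+
  then show ?thesis
    by (simp add: loglr_def sum_subtractf)
qed

lemma mem_GLR_region_iff:
  assumes "x \<in> space (sample_space n)"
  shows "x \<in> GLR_region \<Theta> \<Gamma> g h n \<longleftrightarrow> (SUP \<theta>\<in>\<Theta>. \<Prod>i<n. g \<theta> (x i)) < (SUP \<gamma>\<in>\<Gamma>. \<Prod>i<n. h \<gamma> (x i))"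
proof -
  have "0 < (SUP \<theta>\<in>\<Theta>. \<Prod>i<n. g \<theta> (x i))"
    using g_likelihood_sup(1) likelihood_pos(1) by auto
  then show ?thesis
    using assms by (simp add: GLR_region_def LR_def less_divide_eq)
qed

lemma mem_GLR_version_iff:
  assumes "x \<in> space (sample_space n)"
  shows "x \<in> GLR_version n \<longleftrightarrow> (SUP \<theta>\<in>\<Theta>. \<Prod>i<n. g \<theta> (x i)) < (SUP \<gamma>\<in>\<Gamma>. \<Prod>i<n. h \<gamma> (x i))"
proof -
  have compact: "compact \<Theta>" "compact \<Gamma>"
    using A2 by (auto simp: condition_A2_def)
  have pos: "0 < (SUP \<theta>\<in>\<Theta>. \<Prod>i<n. g \<theta> (x i))"
    using g_likelihood_sup(1) likelihood_pos(1) by auto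
  show ?thesis
    unfolding GLR_version_def using assms pos
    by (simp add: continuous_Sup_dense[OF compact(1) \<Theta>_nonempty dense_\<Theta>(2,3) continuous_likelihoods(1)]
      continuous_Sup_dense[OF compact(2) \<Gamma>_nonempty dense_\<Gamma>(2,3) continuous_likelihoods(2)] ennreal_less_iff)
qed

text \<open>The maximum of the h-likelihood is attained at some \<gamma>, which then beats the
  largest g-likelihood and in particular the one at \<theta>. Taking logarithms of the two positive
  products gives the sum.\<close>

lemma GLR_version_exceedance:
  assumes "x \<in> GLR_version n" "\<theta> \<in> \<Theta>"
  shows "\<exists>\<gamma>\<in>\<Gamma>. 0 \<le> (\<Sum>i<n. loglr (g \<theta>) (h \<gamma>) (x i))"
proof -
  have "(SUP \<theta>\<in>\<Theta>. \<Prod>i<n. g \<theta> (x i)) < (SUP \<gamma>\<in>\<Gamma>. \<Prod>i<n. h \<gamma> (x i))"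
    using assms mem_GLR_version_iff by (auto simp: GLR_version_def)
  moreover obtain \<gamma> where \<gamma>: "\<gamma> \<in> \<Gamma>" "(SUP \<gamma>\<in>\<Gamma>. \<Prod>i<n. h \<gamma> (x i)) = (\<Prod>i<n. h \<gamma> (x i))"
    using h_likelihood_sup(1) by blast
  ultimately have "(\<Prod>i<n. g \<theta> (x i)) \<le> (\<Prod>i<n. h \<gamma> (x i))"
    using g_likelihood_sup(2)[OF assms(2)] by linarith
  then have "ln (\<Prod>i<n. g \<theta> (x i)) \<le> ln (\<Prod>i<n. h \<gamma> (x i))"
    using likelihood_pos assms(2) \<gamma>(1) by (subst ln_le_cancel_iff) auto
  then show ?thesis
    using \<gamma> assms by (auto simp: sum_loglr)
qed

lemma not_GLR_version_exceedance:
  assumes "x \<in> space (sample_space n) - GLR_version n" "\<gamma> \<in> \<Gamma>"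
  shows "\<exists>\<theta>\<in>\<Theta>. (\<Sum>i<n. loglr (g \<theta>) (h \<gamma>) (x i)) \<le> 0"
proof -
  have "(SUP \<gamma>\<in>\<Gamma>. \<Prod>i<n. h \<gamma> (x i)) \<le> (SUP \<theta>\<in>\<Theta>. \<Prod>i<n. g \<theta> (x i))"
    using assms mem_GLR_version_iff by (auto simp: not_less)
  moreover obtain \<theta> where \<theta>: "\<theta> \<in> \<Theta>" "(SUP \<theta>\<in>\<Theta>. \<Prod>i<n. g \<theta> (x i)) = (\<Prod>i<n. g \<theta> (x i))"
    using g_likelihood_sup(1) by blast
  ultimately have "(\<Prod>i<n. h \<gamma> (x i)) \<le> (\<Prod>i<n. g \<theta> (x i))"
    using h_likelihood_sup(2)[OF assms(2)] by linarith
  then have "ln (\<Prod>i<n. h \<gamma> (x i)) \<le> ln (\<Prod>i<n. g \<theta> (x i))"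
    using likelihood_pos assms(2) \<theta>(1) by (subst ln_le_cancel_iff) auto
  then show ?thesis
    using \<theta> assms by (auto simp: sum_loglr)
qed

end

text \<open>The two regions agree on samples of regular points, so under every law of the families
  they, and likewise their complements, differ by a null set that the completion ignores.\<close>

lemma risk_GLR_region:
  assumes f: "f \<in> g ` \<Theta> \<union> h ` \<Gamma>"
  shows "risk \<mu> (g ` \<Theta>) n (GLR_region \<Theta> \<Gamma> g h n) f = risk \<mu> (g ` \<Theta>) n (GLR_version n) f"
proof -
  let ?G = "GLR_region \<Theta> \<Gamma> g h n" and ?M = "sample_law \<mu> f n" and ?\<Omega> = "space (sample_space n)"
  have AE: "AE x in ?M. x \<in> ?G \<longleftrightarrow> x \<in> GLR_version n"
    using AE_sample_regular[OF f, of n] AE_space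
  proof eventually_elim
    case (elim x)
    then show ?case
      using mem_GLR_region_iff[of n x] mem_GLR_version_iff[of n x] by (auto simp: space_sample_law)
  qed
  have V: "GLR_version n \<in> sets ?M" by (simp add: sets_sample_law)
  have G: "?G \<subseteq> ?\<Omega>" by (auto simp: GLR_region_def)
  have C: "emeasure (completion ?M) ?G = emeasure ?M (GLR_version n)"
    using V G AE by (intro emeasure_completion_eq_AE) (auto simp: space_sample_law)
  have "emeasure (completion ?M) (?\<Omega> - ?G) = emeasure ?M (?\<Omega> - GLR_version n)"
    using V AE AE_space
    by (intro emeasure_completion_eq_AE) (auto simp: space_sample_law sets_sample_law elim!: eventually_elim2)
  with C V show ?thesis
    by (simp add: risk_def sets_sample_law)
qed

lemma max_log_risk_GLR_region:
  "max_log_risk \<mu> (g ` \<Theta>) (h ` \<Gamma>) n (GLR_region \<Theta> \<Gamma> g h n) = max_log_risk \<mu> (g ` \<Theta>) (h ` \<Gamma>) n (GLR_version n)"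
  unfolding max_log_risk_def by (intro SUP_cong refl) (simp add: risk_GLR_region)

lemma max_log_risk_GLR_upper:
  assumes r: "\<forall>\<theta>\<in>\<Theta>. \<forall>\<gamma>\<in>\<Gamma>. r \<le> pair_index \<theta> \<gamma>" and e: "0 < e"
  shows "\<forall>\<^sub>F n in sequentially. max_log_risk \<mu> (g ` \<Theta>) (h ` \<Gamma>) n (GLR_region \<Theta> \<Gamma> g h n) \<le> ereal (- r + e)"
  using type_I_error_eventually_le[OF r e] type_II_error_eventually_le[OF r e] eventually_gt_at_top[of 0]
proof eventually_elim
  case (elim n)
  have V: "GLR_version n \<in> sets (sample_space n)" by simp
  have "risk \<mu> (g ` \<Theta>) n (GLR_version n) f \<le> ennreal (exp (- (real n * (r - e))))"
    if "f \<in> g ` \<Theta> \<union> h ` \<Gamma>" for f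
    using that
  proof
    assume "f \<in> g ` \<Theta>"
    then obtain \<theta> where \<theta>: "\<theta> \<in> \<Theta>" "f = g \<theta>" by auto
    have "emeasure (sample_law \<mu> (g \<theta>) n) (GLR_version n) \<le> ennreal (exp (- (real n * (r - e))))"
      using \<theta> GLR_version_exceedance by (intro elim(1)[rule_format]) auto
    then show ?thesis using \<theta> V by (simp add: risk_g)
  next
    assume "f \<in> h ` \<Gamma>"
    then obtain \<gamma> where \<gamma>: "\<gamma> \<in> \<Gamma>" "f = h \<gamma>" by auto
    have "emeasure (sample_law \<mu> (h \<gamma>) n) (space (sample_space n) - GLR_version n) \<le> ennreal (exp (- (real n * (r - e))))"
      using \<gamma> not_GLR_version_exceedance by (intro elim(2)[rule_format]) auto
    then show ?thesis using \<gamma> V by (simp add: risk_h)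
  qed
  then have "elog (risk \<mu> (g ` \<Theta>) n (GLR_version n) f) / ereal (real n) \<le> ereal (- r + e)"
    if "f \<in> g ` \<Theta> \<union> h ` \<Gamma>" for f
  proof -
    assume *: "\<And>f. f \<in> g ` \<Theta> \<union> h ` \<Gamma> \<Longrightarrow> risk \<mu> (g ` \<Theta>) n (GLR_version n) f \<le> ennreal (exp (- (real n * (r - e))))"
    have "elog (risk \<mu> (g ` \<Theta>) n (GLR_version n) f) \<le> ereal (- (real n * (r - e)))"
      using elog_mono[OF *[OF that]] by simp
    then have "elog (risk \<mu> (g ` \<Theta>) n (GLR_version n) f) / ereal (real n) \<le> ereal (- (real n * (r - e))) / ereal (real n)"
      using elim(3) by (intro ereal_divide_right_mono) auto
    also have "\<dots> = ereal (- r + e)"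
      using elim(3) by simp
    finally show ?thesis .
  qed
  then show ?case
    unfolding max_log_risk_GLR_region unfolding max_log_risk_def by (rule SUP_least)
qed

text \<open>The maximal risk is at least the larger of the two errors for this single pair, and the
  larger error is at least half of their sum.\<close>

lemma minimax_lower:
  assumes "\<theta> \<in> \<Theta>" "\<gamma> \<in> \<Gamma>" and r: "pair_index \<theta> \<gamma> < r"
  shows "\<forall>\<^sub>F n in sequentially. ereal (- r) \<le> (INF C \<in> sets (sample_space n). max_log_risk \<mu> (g ` \<Theta>) (h ` \<Gamma>) n C)"
proof -
  interpret p: chernoff_pair "law \<mu> (g \<theta>)" "loglr (g \<theta>) (h \<gamma>)" by (rule chernoff_pair[OF assms(1,2)])
  \<comment> \<open>One half of the gap is spent in \<open>sum_of_errors_ge\<close>; the other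
    leaves a factor \<open>exp (- (real n * e))\<close>, eventually below 1/4, which absorbs the
    constant 1/2 there and the halving of the sum.\<close>
  define e where "e = (r - pair_index \<theta> \<gamma>) / 2"
  have e: "0 < e" using r by (simp add: e_def)
  have "\<forall>\<^sub>F n in sequentially. exp (- (real n * e)) < 1 / 4"
    using e by real_asymp
  then show ?thesis
    using p.sum_of_errors_ge[OF e] eventually_gt_at_top[of 0]
  proof eventually_elim
    case (elim n)
    show ?case
    proof (rule INF_greatest)
      fix C assume C: "C \<in> sets (sample_space n)"
      let ?a = "emeasure (sample_law \<mu> (g \<theta>) n) C"
      let ?b = "emeasure (sample_law \<mu> (h \<gamma>) n) (space (sample_space n) - C)"
      define k where "k = exp (- (real n * r))"
      have "ennreal (exp (- (real n * (pair_index \<theta> \<gamma> + e))) / 2) \<le> ?a + ?b"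
        using elim(2) C sets_sample_law[of "g \<theta>" n] space_sample_law[of "g \<theta>" n]
        by (simp add: Q_eq[OF assms(1,2)] sample_law_def pair_index_def)
      moreover have "2 * k \<le> exp (- (real n * (pair_index \<theta> \<gamma> + e))) / 2"
      proof -
        have "k = exp (- (real n * e)) * exp (- (real n * (pair_index \<theta> \<gamma> + e)))"
          by (simp add: k_def e_def field_simps flip: exp_add)
        also have "\<dots> \<le> 1 / 4 * exp (- (real n * (pair_index \<theta> \<gamma> + e)))"
          using elim(1) by (intro mult_right_mono) auto
        finally show ?thesis by simp
      qed
      ultimately have sum: "ennreal (2 * k) \<le> ?a + ?b"
        by (metis ennreal_leI order.trans)
      have "ennreal k \<le> ?a \<or> ennreal k \<le> ?b"
      proof (rule ccontr)
        assume "\<not> ?thesis"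
        then have "?a + ?b < ennreal k + ennreal k"
          by (intro add_strict_mono) auto
        also have "\<dots> = ennreal (2 * k)"
          by (simp add: k_def flip: ennreal_plus)
        finally show False using sum by simp
      qed
      then obtain f where f: "f \<in> g ` \<Theta> \<union> h ` \<Gamma>" "ennreal k \<le> risk \<mu> (g ` \<Theta>) n C f"
        using risk_g[OF assms(1) C] risk_h[OF assms(2) C] assms(1,2) by (metis UnI1 UnI2 imageI)
      have "ereal (- r) = ereal (- (real n * r)) / ereal (real n)"
        using elim(3) by simp
      also have "\<dots> \<le> elog (risk \<mu> (g ` \<Theta>) n C f) / ereal (real n)"
        using elog_mono[OF f(2)] elim(3) by (intro ereal_divide_right_mono) (auto simp: k_def)
      also have "\<dots> \<le> max_log_risk \<mu> (g ` \<Theta>) (h ` \<Gamma>) n C"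
        unfolding max_log_risk_def using f(1) by (rule SUP_upper)
      finally show "ereal (- r) \<le> max_log_risk \<mu> (g ` \<Theta>) (h ` \<Gamma>) n C" .
    qed
  qed
qed

text \<open>The minimax risk never exceeds that of the likelihood ratio region, since the latter
  equals the risk of a Borel region. A lower bound for the former and an upper bound for the latter
  thus squeeze both sequences to the same limit.\<close>

theorem minimax_risk_tendsto:
  fixes \<rho> :: ereal
  assumes \<rho>: "\<rho> = (INF \<theta>\<in>\<Theta>. INF \<gamma>\<in>\<Gamma>. chernoff_index \<mu> (g \<theta>) (h \<gamma>))"
  shows "(\<lambda>n. INF C \<in> sets (sample_space n). max_log_risk \<mu> (g ` \<Theta>) (h ` \<Gamma>) n C) \<longlonglongrightarrow> - \<rho>"
    and "(\<lambda>n. max_log_risk \<mu> (g ` \<Theta>) (h ` \<Gamma>) n (GLR_region \<Theta> \<Gamma> g h n)) \<longlonglongrightarrow> - \<rho>"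
proof -
  obtain r where r: "\<rho> = ereal r" "\<forall>\<theta>\<in>\<Theta>. \<forall>\<gamma>\<in>\<Gamma>. r \<le> pair_index \<theta> \<gamma>"
    "\<And>e. 0 < e \<Longrightarrow> \<exists>\<theta>\<in>\<Theta>. \<exists>\<gamma>\<in>\<Gamma>. pair_index \<theta> \<gamma> < r + e"
    using INF_chernoff_index unfolding \<rho> by metis
  let ?minimax = "\<lambda>n. INF C \<in> sets (sample_space n). max_log_risk \<mu> (g ` \<Theta>) (h ` \<Gamma>) n C"
  let ?glr = "\<lambda>n. max_log_risk \<mu> (g ` \<Theta>) (h ` \<Gamma>) n (GLR_region \<Theta> \<Gamma> g h n)"
  have le: "?minimax n \<le> ?glr n" for n
    unfolding max_log_risk_GLR_region by (rule INF_lower) simp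
  have "\<forall>\<^sub>F n in sequentially. ereal (- r - e) \<le> ?minimax n \<and> ?glr n \<le> ereal (- r + e)" if e: "0 < e" for e
  proof -
    obtain \<theta> \<gamma> where "\<theta> \<in> \<Theta>" "\<gamma> \<in> \<Gamma>" "pair_index \<theta> \<gamma> < r + e"
      using r(3)[OF e] by blast
    from minimax_lower[OF this] max_log_risk_GLR_upper[OF r(2) e]
    show ?thesis
      by eventually_elim simp
  qed
  note bounds = this
  show "?minimax \<longlonglongrightarrow> - \<rho>" "?glr \<longlonglongrightarrow> - \<rho>"
    unfolding r(1) uminus_ereal.simps
    by (rule ereal_tendstoI, rule eventually_mono[OF bounds]; use le order.trans in blast)+
qed

end

theorem mainTheorem2:
  fixes \<mu> :: "real measure"
    and \<Theta> :: "(real ^ 'p) set" and \<Gamma> :: "(real ^ 'q) set"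
    and g :: "real ^ 'p \<Rightarrow> real \<Rightarrow> real" and h :: "real ^ 'q \<Rightarrow> real \<Rightarrow> real"
    and \<rho> :: ereal
  assumes "sets \<mu> = sets borel"
    and "\<Theta> \<noteq> {}" and "\<Gamma> \<noteq> {}"
    and "\<And>\<theta>. \<theta> \<in> \<Theta> \<Longrightarrow> prob_density \<mu> (g \<theta>)"
    and "\<And>\<gamma>. \<gamma> \<in> \<Gamma> \<Longrightarrow> prob_density \<mu> (h \<gamma>)"
    and "\<And>f f'. f \<in> g ` \<Theta> \<union> h ` \<Gamma> \<Longrightarrow> f' \<in> g ` \<Theta> \<union> h ` \<Gamma> \<Longrightarrow>
           absolutely_continuous (law \<mu> f) (law \<mu> f')"
    and "condition_A1 \<mu> \<Theta> \<Gamma> g h"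
    and "condition_A2 \<Theta> \<Gamma>"
    and "condition_A3 \<mu> \<Theta> \<Gamma> g h"
    and "\<rho> = (INF \<theta>\<in>\<Theta>. INF \<gamma>\<in>\<Gamma>. chernoff_index \<mu> (g \<theta>) (h \<gamma>))"
  shows "((\<lambda>n. INF C \<in> sets (sample_space n). max_log_risk \<mu> (g ` \<Theta>) (h ` \<Gamma>) n C)
            \<longlonglongrightarrow> - \<rho>)
       \<and> ((\<lambda>n. max_log_risk \<mu> (g ` \<Theta>) (h ` \<Gamma>) n (GLR_region \<Theta> \<Gamma> g h n))
            \<longlonglongrightarrow> - \<rho>)"
proof -
  interpret separated_families \<mu> \<Theta> \<Gamma> g h
    by unfold_locales fact+
  show ?thesis
    using minimax_risk_tendsto[OF assms(10)] by blast
qed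

end
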